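(* For every integer $n\ge3$, $\operatorname{rank}(\mathcal{RP}_n)=5$, where $\mathcal{RP}_n$ is the rook partition monoid.
   Context: Write $[n]=\{1,\dots,n\}$, $[n]'=\{1',\dots,n'\}$, $[n]''=\{1'',\dots,n''\}$. A rook partition of degree $n$ is a collection of pairwise disjoint non-empty subsets (called blocks) of $[n]\cup[n]'$; elements of $[n]\cup[n]'$ lying in no block are its rook dots. $\mathcal{RP}_n$ is the set of all rook partitions of degree $n$. Product: for $\alpha,\beta\in\mathcal{RP}_n$, relabel each $i'$ of $\alpha$ as $i''$ to get $\alpha_\vee$, and relabel each $i$ of $\beta$ as $i''$ to get $\beta^\wedge$. Let $\Gamma(\alpha,\beta)$ be the graph on $[n]\cup[n]'\cup[n]''$ in which two vertices are adjacent if they lie in a common block of $\alpha_\vee$ or a common block of $\beta^\wedge$; a vertex is white if it is a rook dot of $\alpha_\vee$ or of $\beta^\wedge$, and black otherwise. Then $\alpha\beta$ is the rook partition such that $x\in[n]\cup[n]'$ is a rook dot of $\alpha\beta$ iff $x$ is connected by a (possibly empty) path to a white vertex in $\Gamma(\alpha,\beta)$, and two elements of $[n]\cup[n]'$ that are not rook dots of $\alpha\beta$ are in the same block iff they are connected by a path in $\Gamma(\alpha,\beta)$. This makes $\mathcal{RP}_n$ a monoid with identity $\{\{1,1'\},\dots,\{n,n'\}\}$. The rank of a semigroup is the smallest size of a (semigroup) generating set. *)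

theory Defs
  imports "HOL-Algebra.Group" "HOL-Library.Disjoint_Sets"
begin

text \<open>
  The three copies of the natural numbers: \<^term>\<open>Plain i\<close> is \<open>i\<close>, \<^term>\<open>Prime i\<close> is \<open>i'\<close>,
  and \<^term>\<open>Dprime i\<close> is \<open>i''\<close>.
\<close>

datatype vertex = Plain nat | Prime nat | Dprime nat

definition points :: "nat \<Rightarrow> vertex set" where
  "points n = Plain ` {1..n} \<union> Prime ` {1..n}"

definition rook_partitions :: "nat \<Rightarrow> vertex set set set" where
  "rook_partitions n = {\<alpha>. \<Union>\<alpha> \<subseteq> points n \<and> disjoint \<alpha> \<and> {} \<notin> \<alpha>}"

definition rook_dots :: "nat \<Rightarrow> vertex set set \<Rightarrow> vertex set" where
  "rook_dots n \<alpha> = points n - \<Union>\<alpha>"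

text \<open>
  The relabellings of the points of the left factor (primed points become double primed) and of
  the right factor (unprimed points become double primed) of a product.
\<close>

fun relabel_left :: "vertex \<Rightarrow> vertex" where
  "relabel_left (Plain i) = Plain i"
| "relabel_left (Prime i) = Dprime i"
| "relabel_left (Dprime i) = Dprime i"

fun relabel_right :: "vertex \<Rightarrow> vertex" where
  "relabel_right (Plain i) = Dprime i"
| "relabel_right (Prime i) = Prime i"
| "relabel_right (Dprime i) = Dprime i"

definition product_graph :: "vertex set set \<Rightarrow> vertex set set \<Rightarrow> (vertex \<times> vertex) set" where
  "product_graph \<alpha> \<beta> =
     {(x, y). x \<noteq> y \<and>
        (\<exists>B \<in> (\<lambda>C. relabel_left ` C) ` \<alpha> \<union> (\<lambda>C. relabel_right ` C) ` \<beta>. x \<in> B \<and> y \<in> B)}"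

definition white_vertices :: "nat \<Rightarrow> vertex set set \<Rightarrow> vertex set set \<Rightarrow> vertex set" where
  "white_vertices n \<alpha> \<beta> = relabel_left ` rook_dots n \<alpha> \<union> relabel_right ` rook_dots n \<beta>"

definition product_dots :: "nat \<Rightarrow> vertex set set \<Rightarrow> vertex set set \<Rightarrow> vertex set" where
  "product_dots n \<alpha> \<beta> =
     {x \<in> points n. \<exists>w \<in> white_vertices n \<alpha> \<beta>. (x, w) \<in> (product_graph \<alpha> \<beta>)\<^sup>*}"

definition rook_mult :: "nat \<Rightarrow> vertex set set \<Rightarrow> vertex set set \<Rightarrow> vertex set set" where
  "rook_mult n \<alpha> \<beta> =
     {{y \<in> points n - product_dots n \<alpha> \<beta>. (x, y) \<in> (product_graph \<alpha> \<beta>)\<^sup>*} |x.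
        x \<in> points n - product_dots n \<alpha> \<beta>}"

definition rook_partition_monoid :: "nat \<Rightarrow> vertex set set monoid" where
  "rook_partition_monoid n =
     \<lparr>carrier = rook_partitions n,
      monoid.mult = rook_mult n,
      one = {{Plain i, Prime i} |i. i \<in> {1..n}}\<rparr>"

inductive_set semigroup_generate :: "('a, 'b) monoid_scheme \<Rightarrow> 'a set \<Rightarrow> 'a set"
  for G and A where
  incl: "a \<in> A \<Longrightarrow> a \<in> semigroup_generate G A"
| mult: "a \<in> semigroup_generate G A \<Longrightarrow> b \<in> semigroup_generate G A \<Longrightarrow>
         a \<otimes>\<^bsub>G\<^esub> b \<in> semigroup_generate G A"

text \<open>
  The rank as a natural number; it is meaningful only for finitely generated semigroups, in
  particular for finite ones.
\<close>

definition semigroup_rank :: "('a, 'b) monoid_scheme \<Rightarrow> nat" where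
  "semigroup_rank G =
     (LEAST k. \<exists>A. A \<subseteq> carrier G \<and> finite A \<and> card A = k \<and>
                   semigroup_generate G A = carrier G)"

text \<open>
  The following facts show that \<^const>\<open>rook_mult\<close> has the two properties that define the product,
  and that the carrier is finite and closed under it.
\<close>

lemma sym_product_graph: "sym ((product_graph \<alpha> \<beta>)\<^sup>*)"
  by (rule sym_rtrancl) (auto simp: sym_def product_graph_def)

lemma Union_rook_mult: "\<Union>(rook_mult n \<alpha> \<beta>) = points n - product_dots n \<alpha> \<beta>"
  unfolding rook_mult_def by blast

lemma rook_dots_rook_mult: "rook_dots n (rook_mult n \<alpha> \<beta>) = product_dots n \<alpha> \<beta>"
  unfolding rook_dots_def Union_rook_mult by (auto simp: product_dots_def)

lemma same_block_rook_mult: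
  assumes "x \<in> points n - product_dots n \<alpha> \<beta>" "y \<in> points n - product_dots n \<alpha> \<beta>"
  shows "(\<exists>B \<in> rook_mult n \<alpha> \<beta>. x \<in> B \<and> y \<in> B) \<longleftrightarrow> (x, y) \<in> (product_graph \<alpha> \<beta>)\<^sup>*"
  using assms unfolding rook_mult_def
  by (auto dest: symD[OF sym_product_graph] intro: rtrancl_trans)

lemma rook_mult_closed: "rook_mult n \<alpha> \<beta> \<in> rook_partitions n"
proof -
  have "disjoint (rook_mult n \<alpha> \<beta>)"
  proof (rule disjointI)
    fix B C assume BC: "B \<in> rook_mult n \<alpha> \<beta>" "C \<in> rook_mult n \<alpha> \<beta>" "B \<noteq> C"
    let ?S = "points n - product_dots n \<alpha> \<beta>" and ?E = "(product_graph \<alpha> \<beta>)\<^sup>*"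
    from BC obtain x y where B: "B = {z \<in> ?S. (x, z) \<in> ?E}" and C: "C = {z \<in> ?S. (y, z) \<in> ?E}"
      unfolding rook_mult_def by blast
    show "B \<inter> C = {}"
    proof (rule ccontr)
      assume "B \<inter> C \<noteq> {}"
      then obtain z where "(x, z) \<in> ?E" "(y, z) \<in> ?E" using B C by blast
      then have "(x, y) \<in> ?E" "(y, x) \<in> ?E"
        by (meson sym_product_graph symD rtrancl_trans)+
      then have "B = C" unfolding B C by (auto intro: rtrancl_trans)
      with BC(3) show False by simp
    qed
  qed
  moreover have "{} \<notin> rook_mult n \<alpha> \<beta>" unfolding rook_mult_def by blast
  ultimately show ?thesis
    using Union_rook_mult[of n \<alpha> \<beta>] by (auto simp: rook_partitions_def)
qed

lemma finite_rook_partitions: "finite (rook_partitions n)"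
proof (rule finite_subset)
  show "rook_partitions n \<subseteq> Pow (Pow (points n))" by (auto simp: rook_partitions_def)
  show "finite (Pow (Pow (points n)))" by (simp add: points_def)
qed

lemma semigroup_generate_subset:
  assumes "A \<subseteq> rook_partitions n"
  shows "semigroup_generate (rook_partition_monoid n) A \<subseteq> rook_partitions n"
proof
  fix a assume "a \<in> semigroup_generate (rook_partition_monoid n) A"
  then show "a \<in> rook_partitions n"
    by induction (use assms in \<open>auto simp: rook_partition_monoid_def rook_mult_closed\<close>)
qed

end

theory Submission
  imports Defs "HOL-Combinatorics.Cycles"
begin

text \<open>
  A rook partition is an equivalence relation on its points together with one further point,
  whose class consists of the rook dots. Left multiplication by a rook partition close to the
  identity identifies two upper points, turns an upper point into a dot, detaches an upper point
  from its block, or permutes the upper points; the involution exchanging \<open>i\<close> and \<open>i'\<close> turns these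
  into right multiplications. Undoing identifications reduces every rook partition to a partial
  matching, and undoing detachments reduces that to a permutation. As the symmetric group is
  generated by a transposition and a cycle, five generators suffice.

  For the lower bound, three defects are inherited from a left factor by the product: some upper
  point is a dot, some block lies in the upper row, two upper points are identified. Permutations
  are the elements without defect, and left multiplication by them preserves the defects. Hence
  an element with exactly one defect requires a generator with exactly this defect, and the
  symmetric group, not being commutative, requires two more.
\<close>

section \<open>Rook partitions as labellings\<close>

text \<open>The blocks are the fibres of the labelling, except that the label \<open>{}\<close> marks the rook dots.\<close>

definition partition_of :: "nat \<Rightarrow> (vertex \<Rightarrow> vertex set) \<Rightarrow> vertex set set" where
  "partition_of n f = {{y \<in> points n. f y = f x} |x. x \<in> points n \<and> f x \<noteq> {}}"

text \<open>Empty at the rook dots, so that \<open>block_of \<alpha>\<close> is a labelling of \<open>\<alpha>\<close>.\<close>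

definition block_of :: "vertex set set \<Rightarrow> vertex \<Rightarrow> vertex set" where
  "block_of \<alpha> x = \<Union>{B \<in> \<alpha>. x \<in> B}"

lemma Plain_in_points [simp]: "Plain i \<in> points n \<longleftrightarrow> i \<in> {1..n}"
  and Prime_in_points [simp]: "Prime i \<in> points n \<longleftrightarrow> i \<in> {1..n}"
  by (auto simp: points_def)

lemma points_cases:
  assumes "x \<in> points n"
  obtains i where "x = Plain i" "i \<in> {1..n}" | i where "x = Prime i" "i \<in> {1..n}"
  using assms by (auto simp: points_def)

lemma partition_of_in_rook_partitions: "partition_of n f \<in> rook_partitions n"
  by (auto simp: rook_partitions_def partition_of_def disjoint_def)

text \<open>Only the kernel of a labelling and the place of its empty label matter, so names of
  blocks can be chosen freely below.\<close>

lemma partition_of_eqI: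
  assumes "\<And>x. x \<in> points n \<Longrightarrow> f x = {} \<longleftrightarrow> g x = {}"
    and "\<And>x y. x \<in> points n \<Longrightarrow> y \<in> points n \<Longrightarrow> f x \<noteq> {} \<Longrightarrow> f x = f y \<longleftrightarrow> g x = g y"
  shows "partition_of n f = partition_of n g"
proof -
  have "{y \<in> points n. f y = f x} = {y \<in> points n. g y = g x}" if "x \<in> points n" "f x \<noteq> {}" for x
    using assms(2)[OF that(1) _ that(2)] by (simp add: eq_commute cong: conj_cong)
  then have "(B = {y \<in> points n. f y = f x} \<and> x \<in> points n \<and> f x \<noteq> {}) \<longleftrightarrow>
      (B = {y \<in> points n. g y = g x} \<and> x \<in> points n \<and> g x \<noteq> {})" for B x
    using assms(1)[of x] by (cases "x \<in> points n"; cases "f x = {}") simp_all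
  then show ?thesis unfolding partition_of_def by simp
qed

lemma rook_dots_partition_of: "rook_dots n (partition_of n f) = {x \<in> points n. f x = {}}"
  by (auto simp: rook_dots_def partition_of_def)

lemma block_of_eq:
  assumes "\<alpha> \<in> rook_partitions n" "B \<in> \<alpha>" "x \<in> B"
  shows "block_of \<alpha> x = B"
proof -
  have "{C \<in> \<alpha>. x \<in> C} = {B}"
    using assms by (auto simp: rook_partitions_def disjoint_def)
  then show ?thesis by (simp add: block_of_def)
qed

lemma block_of_empty_iff:
  "block_of \<alpha> x = {} \<longleftrightarrow> x \<notin> \<Union>\<alpha>"
  by (auto simp: block_of_def)

lemma block_of_cases:
  assumes "\<alpha> \<in> rook_partitions n"
  obtains "block_of \<alpha> x = {}" | "block_of \<alpha> x \<in> \<alpha>" "x \<in> block_of \<alpha> x"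
  using assms block_of_eq block_of_empty_iff by (metis UnionE)

lemma mem_block_of_self: "block_of \<alpha> x \<noteq> {} \<Longrightarrow> x \<in> block_of \<alpha> x"
  by (auto simp: block_of_def)

lemma mem_block_of_eq:
  assumes "\<alpha> \<in> rook_partitions n" "y \<in> block_of \<alpha> x"
  shows "block_of \<alpha> y = block_of \<alpha> x"
  using assms block_of_cases[OF assms(1), of x] block_of_eq[OF assms(1)] by (metis empty_iff)

lemma block_of_subset:
  assumes "\<alpha> \<in> rook_partitions n"
  shows "block_of \<alpha> x \<subseteq> points n"
  using assms by (auto simp: rook_partitions_def block_of_def)

lemma block_of_partition_of:
  assumes "x \<in> points n"
  shows "block_of (partition_of n f) x = (if f x = {} then {} else {y \<in> points n. f y = f x})"
  using assms by (auto simp: block_of_def partition_of_def)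

lemma block_of_partition_of_empty_iff:
  assumes "x \<in> points n"
  shows "block_of (partition_of n f) x = {} \<longleftrightarrow> f x = {}"
  using assms by (auto simp: block_of_empty_iff partition_of_def)

text \<open>Dots need no separate treatment: they share the empty label on one side and the empty
  block on the other.\<close>

lemma block_of_partition_of_eq_iff:
  assumes x: "x \<in> points n" and y: "y \<in> points n"
  shows "block_of (partition_of n f) x = block_of (partition_of n f) y \<longleftrightarrow> f x = f y"
proof
  assume eq: "block_of (partition_of n f) x = block_of (partition_of n f) y"
  show "f x = f y"
  proof (cases "f y = {}")
    case True
    then show ?thesis
      using eq block_of_partition_of_empty_iff[OF x, of f] block_of_partition_of_empty_iff[OF y, of f] by simp
  next
    case False
    then have "f x \<noteq> {}"
      using eq block_of_partition_of_empty_iff[OF x, of f] block_of_partition_of_empty_iff[OF y, of f] by simp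
    moreover have "y \<in> block_of (partition_of n f) x"
      unfolding eq block_of_partition_of[OF y] using False y by simp
    ultimately show ?thesis using block_of_partition_of[OF x, of f] by simp
  qed
qed (simp add: block_of_partition_of x y)

text \<open>Every rook partition thus comes from a labelling, so it suffices to compute products of
  labellings.\<close>

lemma partition_of_block_of:
  assumes \<alpha>: "\<alpha> \<in> rook_partitions n"
  shows "partition_of n (block_of \<alpha>) = \<alpha>"
proof -
  have "{y \<in> points n. block_of \<alpha> y = block_of \<alpha> x} = block_of \<alpha> x"
    if "block_of \<alpha> x \<noteq> {}" for x
  proof (intro equalityI subsetI)
    fix y assume "y \<in> {y \<in> points n. block_of \<alpha> y = block_of \<alpha> x}"
    then show "y \<in> block_of \<alpha> x" using that mem_block_of_self[of \<alpha> y] by simp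
  next
    fix y assume "y \<in> block_of \<alpha> x"
    then show "y \<in> {y \<in> points n. block_of \<alpha> y = block_of \<alpha> x}"
      using mem_block_of_eq[OF \<alpha>, of y x] block_of_subset[OF \<alpha>, of x] by auto
  qed
  then have "(B = {y \<in> points n. block_of \<alpha> y = block_of \<alpha> x} \<and> x \<in> points n \<and> block_of \<alpha> x \<noteq> {})
      \<longleftrightarrow> (B = block_of \<alpha> x \<and> x \<in> points n \<and> block_of \<alpha> x \<noteq> {})" for B x
    by (cases "block_of \<alpha> x = {}") simp_all
  then have "partition_of n (block_of \<alpha>) = {block_of \<alpha> x |x. x \<in> points n \<and> block_of \<alpha> x \<noteq> {}}"
    unfolding partition_of_def by simp
  also have "\<dots> = \<alpha>"
  proof (intro equalityI subsetI)
    fix B assume "B \<in> {block_of \<alpha> x |x. x \<in> points n \<and> block_of \<alpha> x \<noteq> {}}"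
    then show "B \<in> \<alpha>" using block_of_cases[OF \<alpha>] by (elim CollectE exE) metis
  next
    fix B assume B: "B \<in> \<alpha>"
    moreover have "B \<noteq> {}" "B \<subseteq> points n"
      using B \<alpha> unfolding rook_partitions_def by blast+
    ultimately obtain x where x: "x \<in> B" "x \<in> points n"
      by blast
    then show "B \<in> {block_of \<alpha> x |x. x \<in> points n \<and> block_of \<alpha> x \<noteq> {}}"
      using block_of_eq[OF \<alpha> B x(1)] by auto
  qed
  finally show ?thesis .
qed

lemma rook_partition_eqI:
  assumes "\<alpha> \<in> rook_partitions n" "\<beta> \<in> rook_partitions n"
    and "\<And>x. x \<in> points n \<Longrightarrow> block_of \<alpha> x = {} \<longleftrightarrow> block_of \<beta> x = {}"
    and "\<And>x y. x \<in> points n \<Longrightarrow> y \<in> points n \<Longrightarrow> block_of \<alpha> x \<noteq> {} \<Longrightarrow>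
      block_of \<alpha> x = block_of \<alpha> y \<longleftrightarrow> block_of \<beta> x = block_of \<beta> y"
  shows "\<alpha> = \<beta>"
  using partition_of_eqI[of n "block_of \<alpha>" "block_of \<beta>", OF assms(3,4)]
  by (simp add: partition_of_block_of assms(1,2))

section \<open>Components of the product graph\<close>

lemma product_graph_leftI:
  assumes "\<alpha> \<in> rook_partitions n" "block_of \<alpha> x = block_of \<alpha> y" "block_of \<alpha> x \<noteq> {}"
  shows "(relabel_left x, relabel_left y) \<in> (product_graph \<alpha> \<beta>)\<^sup>*"
proof -
  have "block_of \<alpha> x \<in> \<alpha>" "x \<in> block_of \<alpha> x" "y \<in> block_of \<alpha> x"
    using assms block_of_cases[OF assms(1)] by metis+
  then have "relabel_left x \<noteq> relabel_left y \<Longrightarrow> (relabel_left x, relabel_left y) \<in> product_graph \<alpha> \<beta>"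
    unfolding product_graph_def by blast
  then show ?thesis by (cases "relabel_left x = relabel_left y") auto
qed

lemma product_graph_rightI:
  assumes "\<beta> \<in> rook_partitions n" "block_of \<beta> x = block_of \<beta> y" "block_of \<beta> x \<noteq> {}"
  shows "(relabel_right x, relabel_right y) \<in> (product_graph \<alpha> \<beta>)\<^sup>*"
proof -
  have "block_of \<beta> x \<in> \<beta>" "x \<in> block_of \<beta> x" "y \<in> block_of \<beta> x"
    using assms block_of_cases[OF assms(1)] by metis+
  then have "relabel_right x \<noteq> relabel_right y \<Longrightarrow> (relabel_right x, relabel_right y) \<in> product_graph \<alpha> \<beta>"
    unfolding product_graph_def by blast
  then show ?thesis by (cases "relabel_right x = relabel_right y") auto
qed

lemma block_of_rook_mult_empty_iff:
  assumes "x \<in> points n"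
  shows "block_of (rook_mult n \<alpha> \<beta>) x = {} \<longleftrightarrow>
    (\<exists>w \<in> white_vertices n \<alpha> \<beta>. (x, w) \<in> (product_graph \<alpha> \<beta>)\<^sup>*)"
  using assms by (simp add: block_of_empty_iff Union_rook_mult product_dots_def)

text \<open>Two dots share the empty block without having to be connected, hence the condition on
  \<open>x\<close>. If only \<open>y\<close> is a dot, a path from \<open>x\<close> to
  \<open>y\<close> would make \<open>x\<close> a dot as well.\<close>

lemma block_of_rook_mult_eq_iff:
  assumes "x \<in> points n" "y \<in> points n" "block_of (rook_mult n \<alpha> \<beta>) x \<noteq> {}"
  shows "block_of (rook_mult n \<alpha> \<beta>) x = block_of (rook_mult n \<alpha> \<beta>) y \<longleftrightarrow>
    (x, y) \<in> (product_graph \<alpha> \<beta>)\<^sup>*" (is "?b x = ?b y \<longleftrightarrow> _ \<in> ?E")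
proof -
  have x: "x \<in> points n - product_dots n \<alpha> \<beta>"
    using assms by (simp add: block_of_empty_iff Union_rook_mult)
  show ?thesis
  proof (cases "?b y = {}")
    case True
    then have "y \<in> product_dots n \<alpha> \<beta>"
      using assms(2) by (simp add: block_of_empty_iff Union_rook_mult)
    then have "(x, y) \<notin> ?E" using x by (auto simp: product_dots_def intro: rtrancl_trans)
    with True assms(3) show ?thesis by simp
  next
    case False
    then have y: "y \<in> points n - product_dots n \<alpha> \<beta>"
      using assms(2) by (simp add: block_of_empty_iff Union_rook_mult)
    have "?b x = ?b y \<longleftrightarrow> (\<exists>B \<in> rook_mult n \<alpha> \<beta>. x \<in> B \<and> y \<in> B)"
      using block_of_cases[OF rook_mult_closed, of n \<alpha> \<beta>] block_of_eq[OF rook_mult_closed, of _ n \<alpha> \<beta>]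
        assms(3) False by metis
    then show ?thesis using same_block_rook_mult[OF x y] by simp
  qed
qed

lemma rtrancl_invariant:
  assumes "(x, y) \<in> r\<^sup>*" "\<And>x y. (x, y) \<in> r \<Longrightarrow> \<phi> x = \<phi> y"
  shows "\<phi> x = \<phi> y"
  using assms(1)
proof induction
  case (step y z)
  then show ?case using assms(2)[of y z] by simp
qed simp

text \<open>
  If \<open>\<phi>\<close> is constant on the components of the product graph and empty on those with a white
  vertex, then it labels the product as soon as it separates components. To see the latter, leave
  every upper point along one edge for the labelling \<open>b\<close>, unless it is a dot or a component of
  its own.
\<close>

lemma rook_mult_partition_of:
  fixes \<phi> :: "vertex \<Rightarrow> vertex set"
  assumes a: "\<And>x y. x \<in> points n \<Longrightarrow> y \<in> points n \<Longrightarrow> a x = a y \<Longrightarrow> \<phi> (relabel_left x) = \<phi> (relabel_left y)"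
    and a0: "\<And>x. x \<in> points n \<Longrightarrow> a x = {} \<Longrightarrow> \<phi> (relabel_left x) = {}"
    and b: "\<And>x y. x \<in> points n \<Longrightarrow> y \<in> points n \<Longrightarrow> b x = b y \<Longrightarrow> \<phi> (relabel_right x) = \<phi> (relabel_right y)"
    and b0: "\<And>x. x \<in> points n \<Longrightarrow> b x = {} \<Longrightarrow> \<phi> (relabel_right x) = {}"
    and Plain: "\<And>i. i \<in> {1..n} \<Longrightarrow> a (Plain i) = {}
      \<or> (\<exists>j \<in> {1..n}. a (Plain i) = a (Prime j) \<and> b (Plain j) = \<phi> (Plain i))
      \<or> (\<phi> (Plain i) \<noteq> {} \<and> (\<forall>y \<in> points n. \<phi> y = \<phi> (Plain i) \<longrightarrow> y = Plain i))"
    and Prime: "\<And>i. i \<in> {1..n} \<Longrightarrow> b (Prime i) = \<phi> (Prime i)"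
  shows "rook_mult n (partition_of n a) (partition_of n b) = partition_of n \<phi>"
proof -
  let ?\<alpha> = "partition_of n a" and ?\<beta> = "partition_of n b"
  let ?E = "(product_graph ?\<alpha> ?\<beta>)\<^sup>*" and ?W = "white_vertices n ?\<alpha> ?\<beta>"
  note in_rp = partition_of_in_rook_partitions
  \<comment> \<open>Each edge lies in a relabelled block of one factor, where hypothesis
    \<open>a\<close> or \<open>b\<close> makes \<phi> constant.\<close>
  have sound: "\<phi> x = \<phi> y" if "(x, y) \<in> ?E" for x y
    using that
  proof (rule rtrancl_invariant)
    fix x y assume "(x, y) \<in> product_graph ?\<alpha> ?\<beta>"
    then have "(\<exists>C \<in> ?\<alpha>. x \<in> relabel_left ` C \<and> y \<in> relabel_left ` C) \<or>
        (\<exists>C \<in> ?\<beta>. x \<in> relabel_right ` C \<and> y \<in> relabel_right ` C)"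
      unfolding product_graph_def by blast
    then show "\<phi> x = \<phi> y"
    proof (elim disjE bexE conjE)
      fix C assume C: "C \<in> ?\<alpha>" "x \<in> relabel_left ` C" "y \<in> relabel_left ` C"
      obtain z where "C = {y \<in> points n. a y = a z}"
        using C(1) unfolding partition_of_def by blast
      then obtain x' y' where "x = relabel_left x'" "y = relabel_left y'" "x' \<in> points n" "y' \<in> points n" "a x' = a y'"
        using C(2,3) by auto
      then show ?thesis using a by metis
    next
      fix C assume C: "C \<in> ?\<beta>" "x \<in> relabel_right ` C" "y \<in> relabel_right ` C"
      obtain z where "C = {y \<in> points n. b y = b z}"
        using C(1) unfolding partition_of_def by blast
      then obtain x' y' where "x = relabel_right x'" "y = relabel_right y'" "x' \<in> points n" "y' \<in> points n" "b x' = b y'"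
        using C(2,3) by auto
      then show ?thesis using b by metis
    qed
  qed
  have white0: "\<phi> w = {}" if "w \<in> ?W" for w
    using that a0 b0 by (auto simp: white_vertices_def rook_dots_partition_of)
  have leftE: "(relabel_left x, relabel_left y) \<in> ?E"
    if "x \<in> points n" "y \<in> points n" "a x = a y" "a x \<noteq> {}" for x y
    using that by (intro product_graph_leftI[OF in_rp])
      (simp_all add: block_of_partition_of_eq_iff block_of_partition_of_empty_iff)
  have rightE: "(relabel_right x, relabel_right y) \<in> ?E"
    if "x \<in> points n" "y \<in> points n" "b x = b y" "b x \<noteq> {}" for x y
    using that by (intro product_graph_rightI[OF in_rp])
      (simp_all add: block_of_partition_of_eq_iff block_of_partition_of_empty_iff)
  have rightW: "relabel_right x \<in> ?W" if "x \<in> points n" "b x = {}" for x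
    using that by (auto simp: white_vertices_def rook_dots_partition_of)
  \<comment> \<open>The alternatives of \<open>Plain\<close>, extended to both rows: a lower point
    already belongs to the right factor and is its own exit.\<close>
  have exits: "x \<in> ?W \<or> (\<exists>z \<in> points n. (x, relabel_right z) \<in> ?E \<and> b z = \<phi> x)
      \<or> (\<phi> x \<noteq> {} \<and> (\<forall>y \<in> points n. \<phi> y = \<phi> x \<longrightarrow> y = x))" if "x \<in> points n" for x
    using that
  proof (cases rule: points_cases)
    case (1 i)
    show ?thesis
    proof (cases "a (Plain i) = {}")
      case True
      then have "x \<in> relabel_left ` rook_dots n ?\<alpha>"
        using 1 by (intro image_eqI[of _ _ "Plain i"]) (auto simp: rook_dots_partition_of)
      then show ?thesis by (simp add: white_vertices_def)
    next
      case False
      have "\<exists>z \<in> points n. (x, relabel_right z) \<in> ?E \<and> b z = \<phi> x"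
        if "j \<in> {1..n}" "a (Plain i) = a (Prime j)" "b (Plain j) = \<phi> (Plain i)" for j
        using leftE[of "Plain i" "Prime j"] that False 1 by (intro bexI[of _ "Plain j"]) auto
      then show ?thesis using Plain[OF 1(2)] False 1 by blast
    qed
  next
    case (2 i)
    then show ?thesis using Prime[of i] by (intro disjI2 disjI1 bexI[of _ "Prime i"]) auto
  qed
  have dots: "(\<exists>w \<in> ?W. (x, w) \<in> ?E) \<longleftrightarrow> \<phi> x = {}" if x: "x \<in> points n" for x
  proof
    assume "\<phi> x = {}"
    with exits[OF x] rightW show "\<exists>w \<in> ?W. (x, w) \<in> ?E" by (metis rtrancl.rtrancl_refl)
  qed (use sound white0 in blast)
  \<comment> \<open>For distinct points the common label rules out a component of its own, and being
    non-empty it rules out white. Both points therefore lead into the right factor, where one block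
    carries this label.\<close>
  have conn: "(x, y) \<in> ?E"
    if x: "x \<in> points n" and y: "y \<in> points n" and eq: "\<phi> x = \<phi> y" "\<phi> x \<noteq> {}" for x y
  proof (cases "x = y")
    case False
    obtain z where z: "z \<in> points n" "(x, relabel_right z) \<in> ?E" "b z = \<phi> x"
      using exits[OF x] white0[of x] eq x y False by auto
    obtain z' where z': "z' \<in> points n" "(y, relabel_right z') \<in> ?E" "b z' = \<phi> y"
      using exits[OF y] white0[of y] eq x y False by auto
    have "(relabel_right z, relabel_right z') \<in> ?E"
      using rightE[OF z(1) z'(1)] z(3) z'(3) eq by simp
    then show ?thesis using z(2) symD[OF sym_product_graph z'(2)] by (meson rtrancl_trans)
  qed simp
  have emp: "block_of (rook_mult n ?\<alpha> ?\<beta>) x = {} \<longleftrightarrow> \<phi> x = {}" if "x \<in> points n" for x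
    using that by (simp add: block_of_rook_mult_empty_iff dots)
  show ?thesis
  proof (rule rook_partition_eqI[OF rook_mult_closed in_rp])
    fix x assume x: "x \<in> points n"
    show "block_of (rook_mult n ?\<alpha> ?\<beta>) x = {} \<longleftrightarrow> block_of (partition_of n \<phi>) x = {}"
      using x by (simp add: emp block_of_partition_of_empty_iff)
    fix y assume y: "y \<in> points n" and ne: "block_of (rook_mult n ?\<alpha> ?\<beta>) x \<noteq> {}"
    have "(x, y) \<in> ?E \<longleftrightarrow> \<phi> x = \<phi> y"
      using sound conn[OF x y] emp[OF x] ne by blast
    then show "block_of (rook_mult n ?\<alpha> ?\<beta>) x = block_of (rook_mult n ?\<alpha> ?\<beta>) y \<longleftrightarrow>
        block_of (partition_of n \<phi>) x = block_of (partition_of n \<phi>) y"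
      using x y ne by (simp add: block_of_rook_mult_eq_iff block_of_partition_of_eq_iff)
  qed
qed

section \<open>The involution\<close>

text \<open>Fixing the middle row makes \<open>flip\<close> exchange the two relabellings.\<close>

fun flip :: "vertex \<Rightarrow> vertex" where
  "flip (Plain i) = Prime i"
| "flip (Prime i) = Plain i"
| "flip (Dprime i) = Dprime i"

definition star :: "vertex set set \<Rightarrow> vertex set set" where
  "star \<alpha> = (\<lambda>B. flip ` B) ` \<alpha>"

lemma flip_flip [simp]: "flip (flip x) = x"
  by (cases x) auto

lemma flip_in_points [simp]: "flip x \<in> points n \<longleftrightarrow> x \<in> points n"
  by (cases x) auto

lemma inj_flip: "inj flip"
  by (rule inj_on_inverseI[of _ flip]) simp

lemma star_star [simp]: "star (star \<alpha>) = \<alpha>"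
  by (simp add: star_def image_image)

lemma Union_star: "\<Union>(star \<alpha>) = flip ` \<Union>\<alpha>"
  by (auto simp: star_def)

lemma star_in_rook_partitions:
  assumes "\<alpha> \<in> rook_partitions n"
  shows "star \<alpha> \<in> rook_partitions n"
proof -
  have "disjoint \<alpha>" "\<Union>\<alpha> \<subseteq> points n" "{} \<notin> \<alpha>"
    using assms by (simp_all add: rook_partitions_def)
  moreover have "disjoint (star \<alpha>)"
    unfolding star_def using \<open>disjoint \<alpha>\<close> disjoint_image[of flip \<alpha>] inj_flip
    by (simp add: inj_on_subset)
  moreover have "\<Union>(star \<alpha>) \<subseteq> points n"
    unfolding Union_star using \<open>\<Union>\<alpha> \<subseteq> points n\<close> by auto
  ultimately show ?thesis by (auto simp: rook_partitions_def star_def)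
qed

lemma block_of_star: "block_of (star \<alpha>) x = flip ` block_of \<alpha> (flip x)"
proof -
  have "x \<in> flip ` B \<longleftrightarrow> flip x \<in> B" for B
    by (metis flip_flip image_iff)
  then have "{B \<in> star \<alpha>. x \<in> B} = (\<lambda>B. flip ` B) ` {B \<in> \<alpha>. flip x \<in> B}"
    unfolding star_def by blast
  then show ?thesis by (simp add: block_of_def image_Union)
qed

lemma block_of_star_empty_iff: "block_of (star \<alpha>) x = {} \<longleftrightarrow> block_of \<alpha> (flip x) = {}"
  by (simp add: block_of_star)

lemma block_of_star_eq_iff:
  "block_of (star \<alpha>) x = block_of (star \<alpha>) y \<longleftrightarrow> block_of \<alpha> (flip x) = block_of \<alpha> (flip y)"
  by (simp add: block_of_star inj_image_eq_iff[OF inj_flip])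

lemma star_partition_of: "star (partition_of n f) = partition_of n (\<lambda>x. f (flip x))"
  by (rule rook_partition_eqI[OF star_in_rook_partitions[OF partition_of_in_rook_partitions]
        partition_of_in_rook_partitions])
    (simp_all add: block_of_star_empty_iff block_of_star_eq_iff
      block_of_partition_of_empty_iff block_of_partition_of_eq_iff)

lemma relabel_flip:
  "flip (relabel_left x) = relabel_right (flip x)" "flip (relabel_right x) = relabel_left (flip x)"
  by (cases x; simp)+

lemma flip_product_graph:
  assumes "(x, y) \<in> product_graph \<alpha> \<beta>"
  shows "(flip x, flip y) \<in> product_graph (star \<beta>) (star \<alpha>)"
proof -
  have "flip x \<noteq> flip y"
    using assms inj_flip by (auto simp: product_graph_def dest: injD)
  moreover have "(\<exists>C \<in> \<alpha>. x \<in> relabel_left ` C \<and> y \<in> relabel_left ` C) \<or>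
      (\<exists>C \<in> \<beta>. x \<in> relabel_right ` C \<and> y \<in> relabel_right ` C)"
    using assms unfolding product_graph_def by blast
  then have "\<exists>B \<in> (\<lambda>C. relabel_left ` C) ` star \<beta> \<union> (\<lambda>C. relabel_right ` C) ` star \<alpha>.
      flip x \<in> B \<and> flip y \<in> B"
  proof (elim disjE bexE conjE)
    fix C assume C: "C \<in> \<alpha>" "x \<in> relabel_left ` C" "y \<in> relabel_left ` C"
    have "relabel_right ` flip ` C = flip ` relabel_left ` C"
      by (simp add: image_image relabel_flip)
    then have "flip x \<in> relabel_right ` flip ` C \<and> flip y \<in> relabel_right ` flip ` C"
      using C(2,3) by simp
    moreover have "flip ` C \<in> star \<alpha>"
      using C(1) by (simp add: star_def)
    ultimately show ?thesis by (intro bexI[of _ "relabel_right ` flip ` C"] UnI2 imageI)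
  next
    fix C assume C: "C \<in> \<beta>" "x \<in> relabel_right ` C" "y \<in> relabel_right ` C"
    have "relabel_left ` flip ` C = flip ` relabel_right ` C"
      by (simp add: image_image relabel_flip)
    then have "flip x \<in> relabel_left ` flip ` C \<and> flip y \<in> relabel_left ` flip ` C"
      using C(2,3) by simp
    moreover have "flip ` C \<in> star \<beta>"
      using C(1) by (simp add: star_def)
    ultimately show ?thesis by (intro bexI[of _ "relabel_left ` flip ` C"] UnI1 imageI)
  qed
  ultimately show ?thesis by (simp add: product_graph_def)
qed

text \<open>One direction suffices, as \<open>flip\<close> and \<open>star\<close> are their own
  inverses.\<close>

lemma flip_product_graph_rtrancl_iff:
  "(flip x, flip y) \<in> (product_graph (star \<beta>) (star \<alpha>))\<^sup>* \<longleftrightarrow> (x, y) \<in> (product_graph \<alpha> \<beta>)\<^sup>*"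
proof -
  have mono: "(flip x, flip y) \<in> (product_graph (star \<beta>) (star \<alpha>))\<^sup>*"
    if "(x, y) \<in> (product_graph \<alpha> \<beta>)\<^sup>*" for x y \<alpha> \<beta>
    using that
  proof induction
    case (step y z)
    then show ?case using flip_product_graph by (meson rtrancl.rtrancl_into_rtrancl)
  qed simp
  show ?thesis using mono[of x y \<alpha> \<beta>] mono[of "flip x" "flip y" "star \<beta>" "star \<alpha>"] by auto
qed

lemma white_vertices_star: "white_vertices n (star \<beta>) (star \<alpha>) = flip ` white_vertices n \<alpha> \<beta>"
proof -
  have dots: "rook_dots n (star \<gamma>) = flip ` rook_dots n \<gamma>" for \<gamma>
  proof -
    have "flip ` points n = points n"
      by (auto simp: points_def image_Un image_image)
    then show ?thesis
      by (simp add: rook_dots_def Union_star image_set_diff[OF inj_flip])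
  qed
  show ?thesis
    unfolding white_vertices_def dots image_Un image_image relabel_flip by (rule Un_commute)
qed

text \<open>Reflection carries the product graph and its white vertices to those of the reflected
  factors in reverse order. Being an anti-automorphism, it turns facts on left multiplication into
  facts on right multiplication.\<close>

lemma star_rook_mult: "star (rook_mult n \<alpha> \<beta>) = rook_mult n (star \<beta>) (star \<alpha>)"
proof (rule rook_partition_eqI[OF star_in_rook_partitions[OF rook_mult_closed] rook_mult_closed])
  have E: "(x, flip y) \<in> (product_graph (star \<beta>) (star \<alpha>))\<^sup>* \<longleftrightarrow> (flip x, y) \<in> (product_graph \<alpha> \<beta>)\<^sup>*" for x y
    using flip_product_graph_rtrancl_iff[of "flip x" y \<beta> \<alpha>] by simp
  fix x assume x: "x \<in> points n"
  show emp: "block_of (star (rook_mult n \<alpha> \<beta>)) x = {} \<longleftrightarrow> block_of (rook_mult n (star \<beta>) (star \<alpha>)) x = {}"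
    using x by (simp add: block_of_star_empty_iff block_of_rook_mult_empty_iff white_vertices_star E)
  fix y assume y: "y \<in> points n" and ne: "block_of (star (rook_mult n \<alpha> \<beta>)) x \<noteq> {}"
  show "block_of (star (rook_mult n \<alpha> \<beta>)) x = block_of (star (rook_mult n \<alpha> \<beta>)) y \<longleftrightarrow>
      block_of (rook_mult n (star \<beta>) (star \<alpha>)) x = block_of (rook_mult n (star \<beta>) (star \<alpha>)) y"
    using x y ne emp E[of x "flip y"]
    by (simp add: block_of_star_empty_iff block_of_star_eq_iff block_of_rook_mult_eq_iff)
qed

section \<open>Elements close to the identity\<close>

text \<open>The upper point \<open>k\<close> is tied to the lower point \<open>\<pi> k\<close>; the
  singletons serve only as non-empty names of blocks.\<close>

definition perm_rp :: "nat \<Rightarrow> (nat \<Rightarrow> nat) \<Rightarrow> vertex set set" where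
  "perm_rp n \<pi> = partition_of n (case_vertex (\<lambda>k. {Plain (\<pi> k)}) (\<lambda>k. {Plain k}) (\<lambda>_. {}))"

text \<open>The identity with two blocks merged, by giving \<open>j\<close> the name of
  \<open>i\<close> in both rows.\<close>

definition join_rp :: "nat \<Rightarrow> nat \<Rightarrow> nat \<Rightarrow> vertex set set" where
  "join_rp n i j = partition_of n (case_vertex
     (\<lambda>k. {Plain (if k = j then i else k)}) (\<lambda>k. {Plain (if k = j then i else k)}) (\<lambda>_. {}))"

text \<open>The set difference is a compact way to write the empty label at \<open>i\<close> and the
  usual name elsewhere.\<close>

definition dot_rp :: "nat \<Rightarrow> nat \<Rightarrow> vertex set set" where
  "dot_rp n i = partition_of n (case_vertex (\<lambda>k. {Plain k} - {Plain i}) (\<lambda>k. {Plain k} - {Plain i}) (\<lambda>_. {}))"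

text \<open>The name \<open>{Prime i}\<close> occurs nowhere else, so the identity block of
  \<open>i\<close> splits into two singletons.\<close>

definition single_rp :: "nat \<Rightarrow> nat \<Rightarrow> vertex set set" where
  "single_rp n i = partition_of n (case_vertex
     (\<lambda>k. if k = i then {Prime i} else {Plain k}) (\<lambda>k. {Plain k}) (\<lambda>_. {}))"

text \<open>The upper point \<open>k\<close> meets the middle point \<open>\<pi> k\<close> and takes
  its label. The last clause labels the middle row of the product graph.\<close>

lemma perm_rp_mult:
  assumes "\<pi> permutes {1..n}"
  shows "rook_mult n (perm_rp n \<pi>) (partition_of n b) =
    partition_of n (case_vertex (\<lambda>k. b (Plain (\<pi> k))) (\<lambda>k. b (Prime k)) (\<lambda>k. b (Plain k)))"
  unfolding perm_rp_def
proof (rule rook_mult_partition_of, goal_cases)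
  case (5 i)
  then have "\<pi> i \<in> {1..n}" using permutes_in_image[OF assms] by blast
  then show ?case by (simp add: bexI[of _ "\<pi> i"])
next
  case (1 x y)
  then show ?case by (elim points_cases) simp_all
next
  case (3 x y)
  then show ?case by (elim points_cases) simp_all
next
  case (2 x)
  then show ?case by (elim points_cases) simp_all
next
  case (4 x)
  then show ?case by (elim points_cases) simp_all
qed simp

text \<open>The left factor acts first, hence the order of the composition.\<close>

lemma perm_rp_mult_perm_rp:
  assumes "\<pi> permutes {1..n}"
  shows "rook_mult n (perm_rp n \<pi>) (perm_rp n \<rho>) = perm_rp n (\<rho> \<circ> \<pi>)"
  unfolding perm_rp_def[of n \<rho>] perm_rp_mult[OF assms] unfolding perm_rp_def
  by (rule partition_of_eqI) (auto elim!: points_cases)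

lemma star_perm_rp:
  assumes "\<pi> permutes {1..n}"
  shows "star (perm_rp n \<pi>) = perm_rp n (inv_into UNIV \<pi>)"
  unfolding perm_rp_def star_partition_of
  by (rule partition_of_eqI)
    (auto elim!: points_cases simp: permutes_inverses[OF assms] permutes_inv_eq[OF assms]
      dest: injD[OF permutes_inj[OF assms]])

lemma star_join_rp: "star (join_rp n i j) = join_rp n i j"
  unfolding join_rp_def star_partition_of
  by (rule partition_of_eqI; elim points_cases) simp_all

lemma star_dot_rp: "star (dot_rp n i) = dot_rp n i"
  unfolding dot_rp_def star_partition_of
  by (rule partition_of_eqI; elim points_cases) simp_all

lemma star_single_rp: "star (single_rp n i) = single_rp n i"
  unfolding single_rp_def star_partition_of
  by (rule partition_of_eqI) (auto elim!: points_cases split: if_splits)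

section \<open>Factorisations that undo a dot, an identification or a detachment\<close>

definition isolate :: "nat \<Rightarrow> vertex \<Rightarrow> vertex set set \<Rightarrow> vertex set set" where
  "isolate n x \<alpha> = partition_of n ((block_of \<alpha>)(x := {x}))"

text \<open>A block \<open>{x}\<close> can only be the block of \<open>x\<close>. Hence
  \<open>{x}\<close> is a fresh label whenever \<open>x\<close> is not a singleton block, and
  \<open>isolate\<close> really detaches \<open>x\<close>.\<close>

lemma block_of_ne_singleton:
  assumes "\<alpha> \<in> rook_partitions n" "block_of \<alpha> x \<noteq> {x}"
  shows "block_of \<alpha> y \<noteq> {x}"
  using assms mem_block_of_eq[OF assms(1), of x y] by auto

lemma isolate_label_eq:
  assumes "\<alpha> \<in> rook_partitions n" "block_of \<alpha> x \<noteq> {x}"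
    and "((block_of \<alpha>)(x := {x})) y = ((block_of \<alpha>)(x := {x})) z"
  shows "y = z \<or> (y \<noteq> x \<and> z \<noteq> x \<and> block_of \<alpha> y = block_of \<alpha> z)"
  using assms(3) block_of_ne_singleton[OF assms(1,2), of y] block_of_ne_singleton[OF assms(1,2), of z]
  by (simp split: if_splits)

text \<open>The right factor has lost the link of \<open>i\<close>, but the left factor leads the
  upper point \<open>i\<close> to the middle point \<open>j\<close>, which has kept the common
  label. Equal blocks include the case of two dots.\<close>

lemma join_rp_mult_isolate:
  assumes \<alpha>: "\<alpha> \<in> rook_partitions n" and ij: "i \<in> {1..n}" "j \<in> {1..n}" "i \<noteq> j"
    and eq: "block_of \<alpha> (Plain i) = block_of \<alpha> (Plain j)"
  shows "rook_mult n (join_rp n i j) (isolate n (Plain i) \<alpha>) = \<alpha>"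
proof -
  let ?a = "block_of \<alpha>"
  \<comment> \<open>The middle point \<open>k\<close> gets the label of the upper point
    \<open>k\<close> in \<alpha>, also at \<open>i\<close>, where the right factor uses the fresh
    label.\<close>
  let ?\<phi> = "case_vertex (\<lambda>k. ?a (Plain k)) (\<lambda>k. ?a (Prime k)) (\<lambda>k. ?a (Plain k))"
  have ne: "?a (Plain i) \<noteq> {Plain i}"
  proof
    assume "?a (Plain i) = {Plain i}"
    then have "Plain j \<in> {Plain i}" using eq mem_block_of_self[of \<alpha> "Plain j"] by simp
    with ij show False by simp
  qed
  have \<phi>: "?\<phi> (relabel_right z) = ?a z" if "z \<in> points n" for z
    using that by (elim points_cases) simp_all
  have "rook_mult n (join_rp n i j) (isolate n (Plain i) \<alpha>) = partition_of n ?\<phi>"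
    unfolding join_rp_def isolate_def
  proof (rule rook_mult_partition_of, goal_cases)
    case (1 x y)
    then show ?case using eq by (elim points_cases) (simp_all split: if_splits)
  next
    case (2 x)
    then show ?case by (elim points_cases) simp_all
  next
    case (3 x y)
    then show ?case using isolate_label_eq[OF \<alpha> ne] by (auto simp: \<phi>)
  next
    case (4 x)
    then show ?case by (simp add: \<phi> split: if_splits)
  next
    case (5 k)
    have "\<exists>l \<in> {1..n}. (if k = j then i else k) = (if l = j then i else l) \<and>
        ((block_of \<alpha>)(Plain i := {Plain i})) (Plain l) = ?a (Plain k)"
    proof (cases "k = i")
      case True
      then show ?thesis using ij eq by (intro bexI[of _ j]) simp_all
    next
      case False
      then show ?thesis using 5 by (intro bexI[of _ k]) simp_all
    qed
    then show ?case by simp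
  next
    case (6 k)
    then show ?case by simp
  qed
  also have "\<dots> = partition_of n ?a"
    by (rule partition_of_eqI) (auto elim!: points_cases)
  finally show ?thesis using \<alpha> by (simp add: partition_of_block_of)
qed

text \<open>The left factor supplies the dot at the upper point \<open>i\<close>. Its lower
  \<open>i\<close> is a dot too, which whitens the middle point \<open>i\<close>, but this point is
  alone in the right factor and passes nothing on.\<close>

lemma dot_rp_mult_isolate:
  assumes \<alpha>: "\<alpha> \<in> rook_partitions n" and i: "i \<in> {1..n}" and eq: "block_of \<alpha> (Plain i) = {}"
  shows "rook_mult n (dot_rp n i) (isolate n (Plain i) \<alpha>) = \<alpha>"
proof -
  let ?a = "block_of \<alpha>"
  let ?\<phi> = "case_vertex (\<lambda>k. ?a (Plain k)) (\<lambda>k. ?a (Prime k)) (\<lambda>k. ?a (Plain k))"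
  have ne: "?a (Plain i) \<noteq> {Plain i}" using eq by simp
  have \<phi>: "?\<phi> (relabel_right z) = ?a z" if "z \<in> points n" for z
    using that by (elim points_cases) simp_all
  have lab: "{Plain k} - {Plain i} = (if k = i then {} else {Plain k})" for k
    by simp
  have "rook_mult n (dot_rp n i) (isolate n (Plain i) \<alpha>) = partition_of n ?\<phi>"
    unfolding dot_rp_def isolate_def lab
  proof (rule rook_mult_partition_of, goal_cases)
    case (1 x y)
    then show ?case using eq by (elim points_cases) (simp_all split: if_splits)
  next
    case (2 x)
    then show ?case using eq by (elim points_cases) (simp_all split: if_splits)
  next
    case (3 x y)
    then show ?case using isolate_label_eq[OF \<alpha> ne] by (auto simp: \<phi>)
  next
    case (4 x)
    then show ?case by (simp add: \<phi> split: if_splits)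
  next
    case (5 k)
    then show ?case by (cases "k = i") auto
  next
    case (6 k)
    then show ?case by simp
  qed
  also have "\<dots> = partition_of n ?a"
    by (rule partition_of_eqI) (auto elim!: points_cases)
  finally show ?thesis using \<alpha> by (simp add: partition_of_block_of)
qed

text \<open>As \<open>{Prime j}\<close> is the block of the lower point \<open>j\<close>, the update
  ties \<open>i\<close> to it. The left factor cuts this tie: its upper \<open>i\<close> stays
  alone, and the lower \<open>j\<close> is linked only to the middle point \<open>i\<close>, a dead
  end.\<close>

lemma single_rp_mult:
  assumes \<alpha>: "\<alpha> \<in> rook_partitions n" and ij: "i \<in> {1..n}" "j \<in> {1..n}"
    and i: "block_of \<alpha> (Plain i) = {Plain i}" and j: "block_of \<alpha> (Prime j) = {Prime j}"
  shows "rook_mult n (single_rp n i) (partition_of n ((block_of \<alpha>)(Plain i := {Prime j}))) = \<alpha>"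
proof -
  let ?a = "block_of \<alpha>"
  let ?b = "?a(Plain i := {Prime j})"
  let ?\<phi> = "case_vertex (\<lambda>k. ?a (Plain k)) (\<lambda>k. ?a (Prime k)) (\<lambda>k. ?b (Plain k))"
  have \<phi>: "?\<phi> (relabel_right z) = ?b z" if "z \<in> points n" for z
    using that by (elim points_cases) simp_all
  have "rook_mult n (single_rp n i) (partition_of n ?b) = partition_of n ?\<phi>"
    unfolding single_rp_def
  proof (rule rook_mult_partition_of, goal_cases)
    case (1 x y)
    then show ?case by (elim points_cases) (simp_all split: if_splits)
  next
    case (2 x)
    then show ?case by (elim points_cases) (simp_all split: if_splits)
  next
    case (3 x y)
    then show ?case by (simp only: \<phi>)
  next
    case (4 x)
    then show ?case by (simp only: \<phi>)
  next
    case (5 k)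
    show ?case
    proof (cases "k = i")
      case True
      \<comment> \<open>The upper point \<open>i\<close> has no way into the right factor, so the
        third alternative is needed: its label belongs to it alone.\<close>
      have "y = Plain i" if y: "y \<in> points n" and eq: "?\<phi> y = ?\<phi> (Plain i)" for y
      proof -
        have "?a y = {Plain i}" using y eq i by (elim points_cases) simp_all
        then have "y \<in> {Plain i}" using mem_block_of_self[of \<alpha> y] by simp
        then show ?thesis by simp
      qed
      then show ?thesis using True i by simp
    next
      case False
      show ?thesis
        by (rule disjI2, rule disjI1, rule bexI[of _ k]) (use False 5 in simp_all)
    qed
  next
    case (6 k)
    then show ?case by simp
  qed
  also have "\<dots> = partition_of n ?a"
    by (rule partition_of_eqI) (auto elim!: points_cases)
  finally show ?thesis using \<alpha> by (simp add: partition_of_block_of)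
qed

section \<open>Defects and the lower bound\<close>

definition dotted :: "nat \<Rightarrow> vertex set set \<Rightarrow> bool" where
  "dotted n \<alpha> \<longleftrightarrow> (\<exists>i \<in> {1..n}. block_of \<alpha> (Plain i) = {})"

definition hanging :: "nat \<Rightarrow> vertex set set \<Rightarrow> bool" where
  "hanging n \<alpha> \<longleftrightarrow> (\<exists>i \<in> {1..n}. block_of \<alpha> (Plain i) \<noteq> {} \<and>
     (\<forall>j \<in> {1..n}. block_of \<alpha> (Prime j) \<noteq> block_of \<alpha> (Plain i)))"

text \<open>Two dots count as identified: this makes the property inherited by products.\<close>

definition joined :: "nat \<Rightarrow> vertex set set \<Rightarrow> bool" where
  "joined n \<alpha> \<longleftrightarrow> (\<exists>i \<in> {1..n}. \<exists>j \<in> {1..n}. i \<noteq> j \<and> block_of \<alpha> (Plain i) = block_of \<alpha> (Plain j))"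

definition defects :: "nat \<Rightarrow> vertex set set \<Rightarrow> bool \<times> bool \<times> bool" where
  "defects n \<alpha> = (dotted n \<alpha>, hanging n \<alpha>, joined n \<alpha>)"

section \<open>Inheritance of defects from the left factor\<close>

lemma dotted_rook_mult:
  assumes "\<alpha> \<in> rook_partitions n" "dotted n \<alpha>"
  shows "dotted n (rook_mult n \<alpha> \<beta>)"
proof -
  from assms(2) obtain i where i: "i \<in> {1..n}" "block_of \<alpha> (Plain i) = {}"
    by (auto simp: dotted_def)
  then have "Plain i \<in> rook_dots n \<alpha>"
    by (simp add: rook_dots_def block_of_empty_iff)
  then have "relabel_left (Plain i) \<in> white_vertices n \<alpha> \<beta>"
    unfolding white_vertices_def by blast
  then have "block_of (rook_mult n \<alpha> \<beta>) (Plain i) = {}"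
    using i by (subst block_of_rook_mult_empty_iff) auto
  with i show ?thesis unfolding dotted_def by blast
qed

text \<open>A common block of the left factor remains connected in the product graph, so both points
  reach a white vertex or neither does. Two upper dots are white themselves.\<close>

lemma joined_rook_mult:
  assumes \<alpha>: "\<alpha> \<in> rook_partitions n" and "joined n \<alpha>"
  shows "joined n (rook_mult n \<alpha> \<beta>)"
proof -
  from assms(2) obtain i j where ij: "i \<in> {1..n}" "j \<in> {1..n}" "i \<noteq> j"
    and eq: "block_of \<alpha> (Plain i) = block_of \<alpha> (Plain j)"
    unfolding joined_def by blast
  let ?E = "(product_graph \<alpha> \<beta>)\<^sup>*" and ?W = "white_vertices n \<alpha> \<beta>"
  have emp: "block_of (rook_mult n \<alpha> \<beta>) (Plain k) = {} \<longleftrightarrow> (\<exists>w \<in> ?W. (Plain k, w) \<in> ?E)"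
    if "k \<in> {1..n}" for k
    using that by (simp add: block_of_rook_mult_empty_iff)
  have "block_of (rook_mult n \<alpha> \<beta>) (Plain i) = block_of (rook_mult n \<alpha> \<beta>) (Plain j)"
  proof (cases "block_of \<alpha> (Plain i) = {}")
    case True
    have "Plain k \<in> ?W" if "k \<in> {1..n}" "block_of \<alpha> (Plain k) = {}" for k
    proof -
      have "Plain k \<in> rook_dots n \<alpha>"
        using that by (simp add: rook_dots_def block_of_empty_iff)
      then have "relabel_left (Plain k) \<in> ?W" unfolding white_vertices_def by blast
      then show ?thesis by simp
    qed
    then have "Plain i \<in> ?W" "Plain j \<in> ?W" using True eq ij by simp_all
    then have "block_of (rook_mult n \<alpha> \<beta>) (Plain i) = {}" "block_of (rook_mult n \<alpha> \<beta>) (Plain j) = {}"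
      using emp[OF ij(1)] emp[OF ij(2)] by blast+
    then show ?thesis by simp
  next
    case False
    have ijE: "(Plain i, Plain j) \<in> ?E"
      using product_graph_leftI[OF \<alpha> eq False] by simp
    show ?thesis
    proof (cases "block_of (rook_mult n \<alpha> \<beta>) (Plain i) = {}")
      case True
      then have "block_of (rook_mult n \<alpha> \<beta>) (Plain j) = {}"
        using emp[OF ij(1)] emp[OF ij(2)] symD[OF sym_product_graph ijE] by (meson rtrancl_trans)
      with True show ?thesis by simp
    next
      case False
      then show ?thesis using ij ijE by (simp add: block_of_rook_mult_eq_iff)
    qed
  qed
  with ij show ?thesis unfolding joined_def by blast
qed

lemma Plain_notin_relabel_right: "Plain k \<notin> relabel_right ` C"
proof
  assume "Plain k \<in> relabel_right ` C"
  then obtain z where "Plain k = relabel_right z" by blast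
  then show False by (cases z) auto
qed

lemma Plain_in_relabel_left_iff: "Plain k \<in> relabel_left ` C \<longleftrightarrow> Plain k \<in> C"
proof
  assume "Plain k \<in> relabel_left ` C"
  then obtain z where "z \<in> C" "Plain k = relabel_left z" by blast
  then show "Plain k \<in> C" by (cases z) auto
next
  assume "Plain k \<in> C"
  then have "relabel_left (Plain k) \<in> relabel_left ` C" by (rule imageI)
  then show "Plain k \<in> relabel_left ` C" by simp
qed

text \<open>A block in the upper row meets no middle point, so it is a whole component of the
  product graph and contains no white vertex.\<close>

lemma hanging_rook_mult:
  assumes \<alpha>: "\<alpha> \<in> rook_partitions n" and "hanging n \<alpha>"
  shows "hanging n (rook_mult n \<alpha> \<beta>)"
proof -
  from assms(2) obtain i where i: "i \<in> {1..n}" and ne: "block_of \<alpha> (Plain i) \<noteq> {}"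
    and no: "\<And>j. j \<in> {1..n} \<Longrightarrow> block_of \<alpha> (Prime j) \<noteq> block_of \<alpha> (Plain i)"
    unfolding hanging_def by blast
  let ?B = "block_of \<alpha> (Plain i)"
  let ?E = "(product_graph \<alpha> \<beta>)\<^sup>*" and ?W = "white_vertices n \<alpha> \<beta>"
  have plain: "\<exists>k. x = Plain k" if "x \<in> ?B" for x
  proof -
    have "x \<in> points n" using block_of_subset[OF \<alpha>] that by blast
    moreover have "block_of \<alpha> x = ?B" using mem_block_of_eq[OF \<alpha> that] .
    ultimately show ?thesis using no by (elim points_cases) auto
  qed
  have B\<alpha>: "?B \<in> \<alpha>" using block_of_cases[OF \<alpha>, of "Plain i"] ne by blast
  have left_id: "relabel_left x = x" if "x \<in> ?B" for x
    using plain[OF that] by auto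
  \<comment> \<open>Relabelled blocks of the right factor contain no upper points, so an edge
    leaving the block would come from the left factor.\<close>
  have closed: "y \<in> ?B" if x: "x \<in> ?B" and xy: "(x, y) \<in> product_graph \<alpha> \<beta>" for x y
  proof -
    obtain k where k: "x = Plain k" using plain[OF x] by blast
    obtain C where C: "C \<in> \<alpha>" "x \<in> relabel_left ` C" "y \<in> relabel_left ` C"
      using xy Plain_notin_relabel_right[of k] unfolding product_graph_def k by blast
    then have "x \<in> C" by (simp add: k Plain_in_relabel_left_iff)
    then have "C = ?B"
      using block_of_eq[OF \<alpha> C(1)] mem_block_of_eq[OF \<alpha> x] by simp
    then show ?thesis using C(3) left_id by auto
  qed
  have reach: "y \<in> ?B" if "(Plain i, y) \<in> ?E" for y
    using that
  proof induction
    case base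
    show ?case by (rule mem_block_of_self[OF ne])
  next
    case (step y z)
    then show ?case using closed by blast
  qed
  have "w \<notin> ?B" if wW: "w \<in> ?W" for w
  proof
    assume w: "w \<in> ?B"
    obtain k where k: "w = Plain k" using plain[OF w] by blast
    have "w \<in> rook_dots n \<alpha>"
      using wW Plain_notin_relabel_right Plain_in_relabel_left_iff
      unfolding white_vertices_def k Un_iff by blast
    then show False using w B\<alpha> unfolding rook_dots_def by blast
  qed
  then have "block_of (rook_mult n \<alpha> \<beta>) (Plain i) \<noteq> {}"
    using i reach by (subst block_of_rook_mult_empty_iff) auto
  moreover have "block_of (rook_mult n \<alpha> \<beta>) (Prime j) \<noteq> block_of (rook_mult n \<alpha> \<beta>) (Plain i)"
    if j: "j \<in> {1..n}" for j
  proof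
    assume "block_of (rook_mult n \<alpha> \<beta>) (Prime j) = block_of (rook_mult n \<alpha> \<beta>) (Plain i)"
    then have "(Plain i, Prime j) \<in> ?E"
      using i j calculation by (metis block_of_rook_mult_eq_iff Plain_in_points Prime_in_points)
    then have "\<exists>k. Prime j = Plain k" using reach plain by blast
    then show False by simp
  qed
  ultimately show ?thesis using i unfolding hanging_def by blast
qed

section \<open>Permutations and elements with a single defect\<close>

lemma defects_partition_of:
  "dotted n (partition_of n f) \<longleftrightarrow> (\<exists>i \<in> {1..n}. f (Plain i) = {})"
  "hanging n (partition_of n f) \<longleftrightarrow>
    (\<exists>i \<in> {1..n}. f (Plain i) \<noteq> {} \<and> (\<forall>j \<in> {1..n}. f (Prime j) \<noteq> f (Plain i)))"
  "joined n (partition_of n f) \<longleftrightarrow> (\<exists>i \<in> {1..n}. \<exists>j \<in> {1..n}. i \<noteq> j \<and> f (Plain i) = f (Plain j))"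
  unfolding dotted_def hanging_def joined_def
  by (simp_all add: block_of_partition_of_eq_iff block_of_partition_of_empty_iff
      cong: bex_cong ball_cong del: One_nat_def atLeastAtMost_iff)

text \<open>The product only renames the upper row bijectively, and all three defects are
  existential statements about upper points.\<close>

lemma defects_perm_rp_mult:
  assumes \<pi>: "\<pi> permutes {1..n}" and \<gamma>: "\<gamma> \<in> rook_partitions n"
  shows "defects n (rook_mult n (perm_rp n \<pi>) \<gamma>) = defects n \<gamma>"
proof -
  have bex: "(\<exists>i \<in> {1..n}. Q (\<pi> i)) \<longleftrightarrow> (\<exists>i \<in> {1..n}. Q i)" for Q
    using permutes_image[OF \<pi>] by (metis bex_imageD imageI)
  have inj: "\<pi> i = \<pi> j \<longleftrightarrow> i = j" for i j
    using permutes_inj[OF \<pi>] by (simp add: inj_eq)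
  obtain b where b: "\<gamma> = partition_of n b" using partition_of_block_of[OF \<gamma>] by metis
  have "joined n (rook_mult n (perm_rp n \<pi>) \<gamma>) \<longleftrightarrow>
      (\<exists>i \<in> {1..n}. \<exists>j \<in> {1..n}. \<pi> i \<noteq> \<pi> j \<and> b (Plain (\<pi> i)) = b (Plain (\<pi> j)))"
    unfolding b perm_rp_mult[OF \<pi>] defects_partition_of inj by simp
  also have "\<dots> \<longleftrightarrow> joined n \<gamma>"
    unfolding b defects_partition_of
    by (subst bex[of "\<lambda>j. \<pi> _ \<noteq> j \<and> b (Plain (\<pi> _)) = b (Plain j)"]) (rule bex)
  finally have "joined n (rook_mult n (perm_rp n \<pi>) \<gamma>) \<longleftrightarrow> joined n \<gamma>" .
  moreover have "dotted n (rook_mult n (perm_rp n \<pi>) \<gamma>) \<longleftrightarrow> dotted n \<gamma>"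
    unfolding b perm_rp_mult[OF \<pi>] defects_partition_of
    using bex[of "\<lambda>i. b (Plain i) = {}"] by simp
  moreover have "hanging n (rook_mult n (perm_rp n \<pi>) \<gamma>) \<longleftrightarrow> hanging n \<gamma>"
    unfolding b perm_rp_mult[OF \<pi>] defects_partition_of
    using bex[of "\<lambda>i. b (Plain i) \<noteq> {} \<and> (\<forall>j \<in> {1..n}. b (Prime j) \<noteq> b (Plain i))"] by simp
  ultimately show ?thesis by (simp add: defects_def)
qed

text \<open>Without dots and hanging blocks every upper point has a lower partner; without
  identifications partners are distinct. By counting, every lower point is a partner, so the lower
  row allows no further structure.\<close>

lemma perm_rp_cases:
  assumes \<alpha>: "\<alpha> \<in> rook_partitions n" and "defects n \<alpha> = (False, False, False)"
  obtains \<pi> where "\<pi> permutes {1..n}" "\<alpha> = perm_rp n \<pi>"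
proof -
  let ?a = "block_of \<alpha>"
  have dot: "?a (Plain i) \<noteq> {}" if "i \<in> {1..n}" for i
    using assms(2) that unfolding defects_def dotted_def by blast
  have "\<exists>j \<in> {1..n}. ?a (Prime j) = ?a (Plain i)" if "i \<in> {1..n}" for i
    using assms(2) dot[OF that] that unfolding defects_def hanging_def by blast
  then obtain f where f: "\<And>i. i \<in> {1..n} \<Longrightarrow> f i \<in> {1..n}"
    "\<And>i. i \<in> {1..n} \<Longrightarrow> ?a (Prime (f i)) = ?a (Plain i)"
    by metis
  have inj: "i = j" if "i \<in> {1..n}" "j \<in> {1..n}" "?a (Plain i) = ?a (Plain j)" for i j
    using assms(2) that unfolding defects_def joined_def by blast
  have "inj_on f {1..n}"
    using f(2) inj by (intro inj_onI) metis
  moreover have "f ` {1..n} \<subseteq> {1..n}" using f(1) by blast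
  ultimately have "bij_betw f {1..n} {1..n}"
    by (simp add: bij_betw_def endo_inj_surj)
  \<comment> \<open>\<open>permutes\<close> demands the identity outside the interval.\<close>
  define \<pi> where "\<pi> i = (if i \<in> {1..n} then f i else i)" for i
  have "bij_betw \<pi> {1..n} {1..n}"
    using \<open>bij_betw f {1..n} {1..n}\<close> by (subst bij_betw_cong[of _ _ f]) (simp_all add: \<pi>_def)
  then have \<pi>: "\<pi> permutes {1..n}"
    by (intro bij_imp_permutes) (auto simp: \<pi>_def)
  have \<pi>a: "?a (Plain i) = ?a (Prime (\<pi> i))" "\<pi> i \<in> {1..n}" if "i \<in> {1..n}" for i
    using f that by (simp_all add: \<pi>_def)
  \<comment> \<open>Through their partners, lower points inherit what is known of upper
    points.\<close>
  have surj: "\<exists>i \<in> {1..n}. k = \<pi> i" if "k \<in> {1..n}" for k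
    using permutes_image[OF \<pi>] that by blast
  have inj': "?a (Prime k) = ?a (Prime l) \<longleftrightarrow> k = l" if "k \<in> {1..n}" "l \<in> {1..n}" for k l
    using surj[OF that(1)] surj[OF that(2)] inj \<pi>a by metis
  have dot': "?a (Prime k) \<noteq> {}" if "k \<in> {1..n}" for k
    using surj[OF that] dot \<pi>a by metis
  have "partition_of n ?a = perm_rp n \<pi>"
    unfolding perm_rp_def
  proof (rule partition_of_eqI, goal_cases)
    case (1 x)
    then show ?case by (elim points_cases) (simp_all add: dot dot')
  next
    case (2 x y)
    from 2(1,2) show ?case by (elim points_cases) (simp_all add: \<pi>a inj' del: One_nat_def atLeastAtMost_iff)
  qed
  then show thesis using that \<pi> partition_of_block_of[OF \<alpha>] by metis
qed

lemma defects_perm_rp: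
  assumes "\<pi> permutes {1..n}"
  shows "defects n (perm_rp n \<pi>) = (False, False, False)"
proof -
  have "\<exists>j \<in> {1..n}. j = \<pi> i" if "i \<in> {1..n}" for i
    using permutes_in_image[OF assms] that by blast
  then show ?thesis
    using permutes_inj[OF assms] unfolding defects_def perm_rp_def defects_partition_of
    by (simp add: inj_eq)
qed

lemma perm_rp_inject:
  assumes "\<pi> permutes {1..n}" "\<rho> permutes {1..n}" "perm_rp n \<pi> = perm_rp n \<rho>"
  shows "\<pi> = \<rho>"
proof
  fix i
  show "\<pi> i = \<rho> i"
  proof (cases "i \<in> {1..n}")
    case True
    then have \<pi>i: "\<pi> i \<in> {1..n}" using permutes_in_image[OF assms(1)] by blast
    have "block_of (perm_rp n \<pi>) (Plain i) = block_of (perm_rp n \<pi>) (Prime (\<pi> i))"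
      using True \<pi>i unfolding perm_rp_def by (subst block_of_partition_of_eq_iff) simp_all
    then have "block_of (perm_rp n \<rho>) (Plain i) = block_of (perm_rp n \<rho>) (Prime (\<pi> i))"
      using assms(3) by simp
    then show ?thesis
      using True \<pi>i unfolding perm_rp_def by (subst (asm) block_of_partition_of_eq_iff) simp_all
  next
    case False
    then show ?thesis using assms(1,2) by (simp add: permutes_not_in)
  qed
qed

text \<open>With the next two lemmas, this provides for each defect an element having it alone, and
  hence the demand for three separate generators.\<close>

lemma defects_join_rp:
  assumes "i \<in> {1..n}" "j \<in> {1..n}" "i \<noteq> j"
  shows "defects n (join_rp n i j) = (False, False, True)"
proof -
  have "joined n (join_rp n i j)"
    unfolding join_rp_def defects_partition_of using assms
    by (intro bexI[of _ i] bexI[of _ j]) simp_all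
  moreover have "\<not> hanging n (join_rp n i j)"
    unfolding join_rp_def defects_partition_of by auto
  moreover have "\<not> dotted n (join_rp n i j)"
    unfolding join_rp_def defects_partition_of by simp
  ultimately show ?thesis by (simp add: defects_def)
qed

lemma defects_dot_rp:
  assumes "i \<in> {1..n}"
  shows "defects n (dot_rp n i) = (True, False, False)"
proof -
  have "dotted n (dot_rp n i)"
    unfolding dot_rp_def defects_partition_of using assms
    by (intro bexI[of _ i]) simp_all
  moreover have "\<not> hanging n (dot_rp n i)"
    unfolding dot_rp_def defects_partition_of by auto
  \<comment> \<open>As the only upper dot, \<open>i\<close> is identified with no other
    point.\<close>
  moreover have "\<not> joined n (dot_rp n i)"
    unfolding dot_rp_def defects_partition_of by auto
  ultimately show ?thesis by (simp add: defects_def)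
qed

lemma defects_single_rp:
  assumes "i \<in> {1..n}"
  shows "defects n (single_rp n i) = (False, True, False)"
proof -
  have "hanging n (single_rp n i)"
    unfolding single_rp_def defects_partition_of using assms
    by (intro bexI[of _ i]) simp_all
  moreover have "\<not> dotted n (single_rp n i)"
    unfolding single_rp_def defects_partition_of by simp
  moreover have "\<not> joined n (single_rp n i)"
    unfolding single_rp_def defects_partition_of by (auto split: if_splits)
  ultimately show ?thesis by (simp add: defects_def)
qed

section \<open>The lower bound for generating sets\<close>

abbreviation generated :: "nat \<Rightarrow> vertex set set set \<Rightarrow> vertex set set set" where
  "generated n A \<equiv> semigroup_generate (rook_partition_monoid n) A"

lemma generated_mult:
  assumes "\<alpha> \<in> generated n A" "\<beta> \<in> generated n A"
  shows "rook_mult n \<alpha> \<beta> \<in> generated n A"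
  using semigroup_generate.mult[OF assms] by (simp add: rook_partition_monoid_def)

lemma generated_induct [consumes 1, case_names incl mult]:
  assumes "\<alpha> \<in> generated n A"
    and "\<And>\<alpha>. \<alpha> \<in> A \<Longrightarrow> P \<alpha>"
    and "\<And>\<alpha> \<beta>. \<alpha> \<in> generated n A \<Longrightarrow> \<beta> \<in> generated n A \<Longrightarrow> P \<alpha> \<Longrightarrow> P \<beta> \<Longrightarrow> P (rook_mult n \<alpha> \<beta>)"
  shows "P \<alpha>"
  using assms(1)
proof induction
  case (mult \<alpha> \<beta>)
  then show ?case using assms(3)[of \<alpha> \<beta>] by (simp add: rook_partition_monoid_def)
qed (rule assms(2))

text \<open>The left factor has no defects beyond those of the product, so it has exactly these or
  none. If none, it is a permutation and the right factor has the defects of the product.\<close>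

lemma defects_rook_mult:
  assumes \<alpha>: "\<alpha> \<in> rook_partitions n" and \<beta>: "\<beta> \<in> rook_partitions n"
    and eq: "defects n (rook_mult n \<alpha> \<beta>) = s"
    and s: "s \<in> {(False, False, False), (True, False, False), (False, True, False), (False, False, True)}"
  shows "defects n \<alpha> = s \<or> (defects n \<alpha> = (False, False, False) \<and> defects n \<beta> = s)"
proof (cases "defects n \<alpha> = (False, False, False)")
  case True
  then obtain \<pi> where "\<pi> permutes {1..n}" "\<alpha> = perm_rp n \<pi>" by (rule perm_rp_cases[OF \<alpha>])
  then have "defects n \<beta> = s" using defects_perm_rp_mult[OF _ \<beta>] eq by simp
  with True show ?thesis by simp
next
  case False
  then show ?thesis
    using eq s dotted_rook_mult[OF \<alpha>] hanging_rook_mult[OF \<alpha>] joined_rook_mult[OF \<alpha>]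
    unfolding defects_def by auto
qed

text \<open>A single defect can be traced through products to a factor with just this defect, and
  finally to a generator.\<close>

lemma generator_with_defects:
  assumes A: "A \<subseteq> rook_partitions n" and "\<alpha> \<in> generated n A" and "defects n \<alpha> = s"
    and s: "s \<in> {(True, False, False), (False, True, False), (False, False, True)}"
  shows "\<exists>\<beta> \<in> A. defects n \<beta> = s"
  using assms(2,3)
proof (induction rule: generated_induct)
  case (mult \<alpha> \<beta>)
  have "\<alpha> \<in> rook_partitions n" "\<beta> \<in> rook_partitions n"
    using mult.hyps semigroup_generate_subset[OF A] by blast+
  then have "defects n \<alpha> = s \<or> defects n \<beta> = s"
    using defects_rook_mult[OF _ _ mult.prems] s by blast
  then show ?case using mult.IH by blast
qed blast

text \<open>A product without defects has factors without defects, so permutations arise only from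
  permutations in \<open>A\<close>. The condition \<open>unit\<close> also admits that there are
  none.\<close>

lemma generated_by_single_unit:
  assumes A: "A \<subseteq> rook_partitions n" and \<gamma>: "\<gamma> permutes {1..n}"
    and unit: "\<And>\<alpha>. \<alpha> \<in> A \<Longrightarrow> defects n \<alpha> = (False, False, False) \<Longrightarrow> \<alpha> = perm_rp n \<gamma>"
    and "\<alpha> \<in> generated n A" "defects n \<alpha> = (False, False, False)"
  shows "\<exists>k. \<alpha> = perm_rp n (\<gamma> ^^ k)"
  using assms(4,5)
proof (induction rule: generated_induct)
  case (incl \<alpha>)
  then have "\<alpha> = perm_rp n (\<gamma> ^^ 1)" using unit by simp
  then show ?case by blast
next
  case (mult \<alpha> \<beta>)
  have "\<alpha> \<in> rook_partitions n" "\<beta> \<in> rook_partitions n"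
    using mult.hyps semigroup_generate_subset[OF A] by blast+
  then have "defects n \<alpha> = (False, False, False)"
    using defects_rook_mult[OF _ _ mult.prems] by blast
  then obtain k where k: "\<alpha> = perm_rp n (\<gamma> ^^ k)" using mult.IH(1) by blast
  have \<gamma>k: "(\<gamma> ^^ k) permutes {1..n}" by (rule permutes_funpow[OF \<gamma>])
  have "defects n \<beta> = (False, False, False)"
    using mult.prems defects_perm_rp_mult[OF \<gamma>k \<open>\<beta> \<in> rook_partitions n\<close>] k by simp
  then obtain l where l: "\<beta> = perm_rp n (\<gamma> ^^ l)" using mult.IH(2) by blast
  have "rook_mult n \<alpha> \<beta> = perm_rp n (\<gamma> ^^ (l + k))"
    unfolding k l perm_rp_mult_perm_rp[OF \<gamma>k] by (simp add: funpow_add)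
  then show ?case by blast
qed

lemma perm_rp_in_rook_partitions: "perm_rp n \<pi> \<in> rook_partitions n"
  and join_rp_in_rook_partitions: "join_rp n i j \<in> rook_partitions n"
  and dot_rp_in_rook_partitions: "dot_rp n i \<in> rook_partitions n"
  and single_rp_in_rook_partitions: "single_rp n i \<in> rook_partitions n"
  unfolding perm_rp_def join_rp_def dot_rp_def single_rp_def
  by (rule partition_of_in_rook_partitions)+

lemma card_generating_set_ge:
  assumes n: "n \<ge> 3" and A: "A \<subseteq> rook_partitions n" and gen: "generated n A = rook_partitions n"
  shows "card A \<ge> 5"
proof -
  have finA: "finite A" by (rule finite_subset[OF A finite_rook_partitions])
  have "\<exists>\<alpha> \<in> A. defects n \<alpha> = (True, False, False)"
    using n gen dot_rp_in_rook_partitions by (intro generator_with_defects[OF A _ defects_dot_rp[of 1]]) auto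
  then obtain d where d: "d \<in> A" "defects n d = (True, False, False)" by blast
  have "\<exists>\<alpha> \<in> A. defects n \<alpha> = (False, True, False)"
    using n gen single_rp_in_rook_partitions by (intro generator_with_defects[OF A _ defects_single_rp[of 1]]) auto
  then obtain h where h: "h \<in> A" "defects n h = (False, True, False)" by blast
  have "\<exists>\<alpha> \<in> A. defects n \<alpha> = (False, False, True)"
    using n gen join_rp_in_rook_partitions by (intro generator_with_defects[OF A _ defects_join_rp[of 1 _ 2]]) auto
  then obtain j where j: "j \<in> A" "defects n j = (False, False, True)" by blast
  \<comment> \<open>With at most one permutation in \<open>A\<close>, all permutations would be
    powers of a single one.\<close>
  have "\<exists>u \<in> A. \<exists>v \<in> A. u \<noteq> v \<and> defects n u = (False, False, False) \<and> defects n v = (False, False, False)"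
  proof (rule ccontr)
    assume "\<not> ?thesis"
    then have uniq: "u = v" if "u \<in> A" "v \<in> A" "defects n u = (False, False, False)"
      "defects n v = (False, False, False)" for u v
      using that by blast
    have "\<exists>\<gamma>. \<gamma> permutes {1..n} \<and> (\<forall>\<alpha> \<in> A. defects n \<alpha> = (False, False, False) \<longrightarrow> \<alpha> = perm_rp n \<gamma>)"
    proof (cases "\<exists>u \<in> A. defects n u = (False, False, False)")
      case True
      then obtain u where u: "u \<in> A" "defects n u = (False, False, False)" by blast
      moreover obtain \<gamma> where "\<gamma> permutes {1..n}" "u = perm_rp n \<gamma>"
        using perm_rp_cases[of u n] u A by blast
      ultimately show ?thesis using uniq by blast
    next
      \<comment> \<open>With no permutation in \<open>A\<close> the condition is vacuous, and the
        identity serves.\<close>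
      case False
      then show ?thesis using permutes_id by blast
    qed
    then obtain \<gamma> where \<gamma>: "\<gamma> permutes {1..n}"
      and unit: "\<And>\<alpha>. \<alpha> \<in> A \<Longrightarrow> defects n \<alpha> = (False, False, False) \<Longrightarrow> \<alpha> = perm_rp n \<gamma>" by blast
    have power: "\<exists>k. \<pi> = \<gamma> ^^ k" if \<pi>: "\<pi> permutes {1..n}" for \<pi>
    proof -
      have "perm_rp n \<pi> \<in> generated n A" using gen perm_rp_in_rook_partitions by simp
      then obtain k where "perm_rp n \<pi> = perm_rp n (\<gamma> ^^ k)"
        using generated_by_single_unit[OF A \<gamma> unit _ defects_perm_rp[OF \<pi>]] by blast
      then show ?thesis using perm_rp_inject[OF \<pi> permutes_funpow[OF \<gamma>]] by blast
    qed
    \<comment> \<open>Two overlapping transpositions need three points, hence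
      \<open>n \<ge> 3\<close>; as powers of \<gamma> they would commute.\<close>
    obtain k l where "transpose 1 2 = \<gamma> ^^ k" "transpose 2 3 = \<gamma> ^^ l"
      using power[OF permutes_swap_id[of 1 _ 2]] power[OF permutes_swap_id[of 2 _ 3]] n by auto
    then have "transpose 1 2 \<circ> transpose 2 3 = transpose 2 3 \<circ> transpose 1 (2 :: nat)"
      by (metis add.commute funpow_add)
    \<comment> \<open>The left side sends 1 to 2, the right side sends 1 to 3.\<close>
    then have "(transpose 1 2 \<circ> transpose 2 3) 1 = (transpose 2 3 \<circ> transpose 1 (2 :: nat)) 1" by simp
    then show False by (simp add: transpose_def)
  qed
  then obtain u v where uv: "u \<in> A" "v \<in> A" "u \<noteq> v"
    "defects n u = (False, False, False)" "defects n v = (False, False, False)" by blast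
  \<comment> \<open>The defect triples tell all five apart except \<open>u\<close> and
    \<open>v\<close>, which were chosen distinct.\<close>
  have "d \<notin> {h, j, u, v}" "h \<notin> {j, u, v}" "j \<notin> {u, v}"
    using d(2) h(2) j(2) uv(4,5) by fastforce+
  then have "card {d, h, j, u, v} = 5"
    using uv(3) by simp
  moreover have "{d, h, j, u, v} \<subseteq> A" using d h j uv by blast
  ultimately show ?thesis using card_mono[OF finA, of "{d, h, j, u, v}"] by simp
qed

section \<open>Five generators\<close>

text \<open>The cycle through 1, 2, ..., n. As points are numbered from 1, the residue is taken
  before adding 1, so \<open>n\<close> goes to 1.\<close>

definition rotation :: "nat \<Rightarrow> nat \<Rightarrow> nat" where
  "rotation n k = (if k \<in> {1..n} then k mod n + 1 else k)"

lemma funpow_rotation: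
  assumes "k \<in> {1..n}"
  shows "(rotation n ^^ m) k = (k - 1 + m) mod n + 1"
proof (induction m)
  case 0
  then show ?case using assms by auto
next
  case (Suc m)
  have "(k - 1 + m) mod n + 1 \<in> {1..n}" using assms by (simp add: Suc_le_eq)
  then show ?case using Suc by (simp add: rotation_def mod_Suc_eq)
qed

text \<open>Consequently the inverse of the rotation is its power with exponent
  \<open>n - 1\<close>, which is available in a semigroup when this exponent is positive.\<close>

lemma funpow_rotation_self: "rotation n ^^ n = id"
proof
  fix k
  show "(rotation n ^^ n) k = id k"
  proof (cases "k \<in> {1..n}")
    case True
    then have "k - 1 < n" by auto
    then have "(k - 1 + n) mod n = k - 1" by (simp only: mod_add_self2 mod_less)
    then show ?thesis using funpow_rotation[OF True, of n] True by simp
  next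
    case False
    then have "(rotation n ^^ m) k = k" for m
      by (induction m) (auto simp: rotation_def)
    then show ?thesis by simp
  qed
qed

lemma rotation_permutes:
  assumes "n \<ge> 1"
  shows "rotation n permutes {1..n}"
proof (rule bij_imp_permutes)
  have "rotation n \<circ> rotation n ^^ (n - 1) = id" "rotation n ^^ (n - 1) \<circ> rotation n = id"
    using assms funpow_rotation_self[of n]
    by (simp_all flip: funpow.simps(2) funpow_Suc_right)
  then have bij: "bij (rotation n)" by (metis o_bij)
  have "rotation n ` {1..n} \<subseteq> {1..n}" using assms by (auto simp: rotation_def Suc_le_eq)
  then show "bij_betw (rotation n) {1..n} {1..n}"
    using bij by (simp add: bij_betw_def endo_inj_surj inj_on_subset[OF bij_is_inj])
qed (auto simp: rotation_def)

text \<open>Only closure under composition is assumed, as a semigroup need not offer identity and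
  inverses: the inverse rotation is a positive power, and the identity is the square of a
  transposition. All transpositions arise by conjugation.\<close>

lemma permutes_induct_rotation:
  assumes n: "n \<ge> 2" and \<pi>: "\<pi> permutes {1..n}"
    and comp: "\<And>f g. P f \<Longrightarrow> P g \<Longrightarrow> P (f \<circ> g)"
    and swap: "P (transpose 1 2)" and rot: "P (rotation n)"
  shows "P \<pi>"
proof -
  have conj: "P (transpose (f a) (f b))"
    if P: "P f" "P f'" "P (transpose a b)" and inv: "f \<circ> f' = id" "f' \<circ> f = id" for f f' a b
  proof -
    have "inj f" using inv(2) by (metis inj_on_id inj_on_imageI2)
    have "(f \<circ> (transpose a b \<circ> f')) x = transpose (f a) (f b) x" for x
    proof -
      have "f (f' x) = x" using inv(1) by (metis comp_apply id_apply)
      then obtain y where y: "x = f y" by metis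
      have "f' (f y) = y" using inv(2) by (metis comp_apply id_apply)
      then show ?thesis
        using \<open>inj f\<close> unfolding y by (simp add: transpose_def inj_eq)
    qed
    then have "f \<circ> (transpose a b \<circ> f') = transpose (f a) (f b)" by blast
    then show ?thesis using comp[OF P(1) comp[OF P(3,2)]] by simp
  qed
  have pow: "P (rotation n ^^ Suc m)" for m
  proof (induction m)
    case (Suc m)
    then show ?case unfolding funpow.simps(2)[of "Suc m"] by (rule comp[OF rot])
  qed (simp add: rot)
  have rotinv: "rotation n \<circ> rotation n ^^ (n - 1) = id" "rotation n ^^ (n - 1) \<circ> rotation n = id"
    using n funpow_rotation_self[of n]
    by (simp_all flip: funpow.simps(2) funpow_Suc_right)
  \<comment> \<open>Here \<open>n \<ge> 2\<close> makes the exponent positive.\<close>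
  have rot': "P (rotation n ^^ (n - 1))"
    using pow[of "n - 2"] n by (simp add: numeral_2_eq_2 Suc_diff_Suc del: funpow.simps)
  \<comment> \<open>Conjugation by the rotation shifts a pair of neighbours by one; nothing wraps
    around before \<open>n\<close>.\<close>
  have adj: "P (transpose i (Suc i))" if "1 \<le> i" "i < n" for i
    using that
  proof (induction i rule: dec_induct)
    case base
    then show ?case using swap by (simp add: numeral_2_eq_2)
  next
    case (step i)
    then have "P (transpose (rotation n i) (rotation n (Suc i)))"
      by (intro conj[OF rot rot' _ rotinv, of i "Suc i"]) simp
    then show ?case using step by (simp add: rotation_def)
  qed
  \<comment> \<open>Conjugation by the swap of \<open>k\<close> and its successor fixes 1 and moves
    \<open>k\<close> one further.\<close>
  have swap1: "P (transpose 1 k)" if "2 \<le> k" "k \<le> n" for k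
    using that
  proof (induction k rule: dec_induct)
    case (step k)
    have "P (transpose (transpose k (Suc k) 1) (transpose k (Suc k) k))"
      by (rule conj[of "transpose k (Suc k)" "transpose k (Suc k)" 1 k]) (use step adj[of k] in simp_all)
    then show ?case using step by simp
  qed (rule swap)
  have all: "P (transpose a b)" if ab: "a \<in> {1..n}" "b \<in> {1..n}" "a \<noteq> b" for a b
  proof -
    consider "a = 1" | "b = 1" | "a \<noteq> 1" "b \<noteq> 1" by blast
    then show ?thesis
    proof cases
      case 1
      then show ?thesis using swap1[of b] ab by simp
    next
      case 2
      then show ?thesis using swap1[of a] ab by (simp add: transpose_commute)
    next
      case 3
      \<comment> \<open>Conjugation by the swap of 1 and \<open>a\<close> replaces 1 by
        \<open>a\<close> and fixes \<open>b\<close>.\<close>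
      then have "P (transpose (transpose 1 a 1) (transpose 1 a b))"
        using swap1[of a] swap1[of b] ab
        by (intro conj[of "transpose 1 a" "transpose 1 a" 1 b]) simp_all
      then show ?thesis using 3 ab by simp
    qed
  qed
  from \<pi> finite_atLeastAtMost show ?thesis
  proof (induction rule: permutes_induct)
    case id
    then show ?case using comp[OF swap swap] by (simp only: transpose_comp_involutory)
  next
    case (swap a b p)
    then show ?case using comp all by blast
  qed
qed

section \<open>Generating the elements close to the identity\<close>

definition rook_generators :: "nat \<Rightarrow> vertex set set set" where
  "rook_generators n =
     {perm_rp n (transpose 1 2), perm_rp n (rotation n), join_rp n 1 2, dot_rp n 1, single_rp n 1}"

lemma rook_generators_subset: "rook_generators n \<subseteq> rook_partitions n"
  by (simp add: rook_generators_def perm_rp_in_rook_partitions join_rp_in_rook_partitions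
      dot_rp_in_rook_partitions single_rp_in_rook_partitions)

lemma perm_rp_generated:
  assumes n: "n \<ge> 2" and \<pi>: "\<pi> permutes {1..n}"
  shows "perm_rp n \<pi> \<in> generated n (rook_generators n)"
proof -
  \<comment> \<open>The predicate carries \<open>permutes\<close> along, because the product formula
    for permutations requires it.\<close>
  have "\<pi> permutes {1..n} \<and> perm_rp n \<pi> \<in> generated n (rook_generators n)"
  proof (rule permutes_induct_rotation[OF n \<pi>], goal_cases)
    case (1 f g)
    then have "rook_mult n (perm_rp n g) (perm_rp n f) \<in> generated n (rook_generators n)"
      by (intro generated_mult) simp_all
    moreover have "rook_mult n (perm_rp n g) (perm_rp n f) = perm_rp n (f \<circ> g)"
      using 1 by (intro perm_rp_mult_perm_rp) blast
    ultimately show ?case using 1 permutes_compose by metis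
  next
    case 2
    have "perm_rp n (transpose 1 2) \<in> rook_generators n" by (simp add: rook_generators_def)
    then show ?case
      using n permutes_swap_id[of 1 "{1..n}" 2] by (simp add: semigroup_generate.incl)
  next
    case 3
    have "perm_rp n (rotation n) \<in> rook_generators n" by (simp add: rook_generators_def)
    then show ?case
      using n rotation_permutes[of n] by (simp add: semigroup_generate.incl)
  qed
  then show ?thesis by simp
qed

text \<open>Reflection fixes three generators and inverts the two permutations, whose inverses are
  generated; the anti-automorphism extends this to products. So the lower row can be treated like
  the upper one.\<close>

lemma star_generated:
  assumes n: "n \<ge> 2" and "\<alpha> \<in> generated n (rook_generators n)"
  shows "star \<alpha> \<in> generated n (rook_generators n)"
  using assms(2)
proof (induction rule: generated_induct)
  case (incl \<alpha>)
  have perm: "star (perm_rp n \<pi>) \<in> generated n (rook_generators n)" if "\<pi> permutes {1..n}" for \<pi>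
    using that n by (simp add: star_perm_rp perm_rp_generated permutes_inv)
  from incl consider "\<alpha> = perm_rp n (transpose 1 2)" | "\<alpha> = perm_rp n (rotation n)" | "star \<alpha> = \<alpha>"
    unfolding rook_generators_def using star_join_rp star_dot_rp star_single_rp by blast
  then show ?case
  proof cases
    case 1
    then show ?thesis using perm[OF permutes_swap_id[of 1 "{1..n}" 2]] n by simp
  next
    case 2
    then show ?thesis using perm[OF rotation_permutes] n by simp
  next
    case 3
    then show ?thesis using incl by (simp add: semigroup_generate.incl)
  qed
next
  case (mult \<alpha> \<beta>)
  then show ?case by (simp add: star_rook_mult generated_mult)
qed

text \<open>Conjugation by a permutation renames both rows alike. The multiplication on the right is
  a left multiplication between two reflections.\<close>

lemma relabelled_generated:
  assumes n: "n \<ge> 2" and \<pi>: "\<pi> permutes {1..n}"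
    and b: "partition_of n b \<in> generated n (rook_generators n)"
  shows "partition_of n (case_vertex (\<lambda>k. b (Plain (\<pi> k))) (\<lambda>k. b (Prime (\<pi> k))) (\<lambda>_. {}))
    \<in> generated n (rook_generators n)"
proof -
  have perm: "perm_rp n \<pi> \<in> generated n (rook_generators n)" by (rule perm_rp_generated[OF n \<pi>])
  let ?c = "rook_mult n (perm_rp n \<pi>) (star (rook_mult n (perm_rp n \<pi>) (partition_of n b)))"
  have "star ?c \<in> generated n (rook_generators n)"
    by (intro star_generated[OF n] generated_mult perm b)
  also have "star ?c = partition_of n (case_vertex (\<lambda>k. b (Plain (\<pi> k))) (\<lambda>k. b (Prime (\<pi> k))) (\<lambda>_. {}))"
    unfolding perm_rp_mult[OF \<pi>] star_partition_of
    by (rule partition_of_eqI; elim points_cases) simp_all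
  finally show ?thesis .
qed

lemma join_rp_generated:
  assumes n: "n \<ge> 2" and ij: "i \<in> {1..n}" "j \<in> {1..n}" "i \<noteq> j"
  shows "join_rp n i j \<in> generated n (rook_generators n)"
proof -
  \<comment> \<open>\<open>transpose i 1\<close> sends \<open>i\<close> to 1 and \<open>j\<close> to
    a point other than 1; the outer transposition moves that point to 2 and fixes 1.\<close>
  define \<pi> where "\<pi> = transpose (transpose i 1 j) 2 \<circ> transpose i 1"
  have "transpose i 1 j \<in> {1..n}" using ij by (simp add: transpose_def)
  then have \<pi>: "\<pi> permutes {1..n}"
    unfolding \<pi>_def using n ij by (intro permutes_compose permutes_swap_id) auto
  have "\<pi> i = 1" "\<pi> j = 2" using ij by (auto simp: \<pi>_def transpose_def)
  then have iff: "\<pi> k = 2 \<longleftrightarrow> k = j" "\<pi> k = 1 \<longleftrightarrow> k = i" for k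
    using permutes_inj[OF \<pi>] by (metis injD)+
  have eq: "\<pi> k = \<pi> l \<longleftrightarrow> k = l" for k l
    using permutes_inj[OF \<pi>] by (simp add: inj_eq)
  have gen: "join_rp n 1 2 \<in> generated n (rook_generators n)"
    by (rule semigroup_generate.incl) (simp add: rook_generators_def)
  have "partition_of n (case_vertex
      (\<lambda>k. {Plain (if \<pi> k = 2 then 1 else \<pi> k)}) (\<lambda>k. {Plain (if \<pi> k = 2 then 1 else \<pi> k)}) (\<lambda>_. {}))
      \<in> generated n (rook_generators n)"
    using relabelled_generated[OF n \<pi> gen[unfolded join_rp_def]] by (simp only: vertex.case)
  also have "partition_of n (case_vertex
      (\<lambda>k. {Plain (if \<pi> k = 2 then 1 else \<pi> k)}) (\<lambda>k. {Plain (if \<pi> k = 2 then 1 else \<pi> k)}) (\<lambda>_. {}))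
      = join_rp n i j"
  proof -
    have "(if \<pi> k = 2 then 1 else \<pi> k) = \<pi> (if k = j then i else k)" for k
      using \<open>\<pi> i = 1\<close> by (simp add: iff)
    then show ?thesis unfolding join_rp_def
      by (intro partition_of_eqI; elim points_cases) (simp_all add: eq)
  qed
  finally show ?thesis .
qed

lemma dot_rp_generated:
  assumes n: "n \<ge> 2" and i: "i \<in> {1..n}"
  shows "dot_rp n i \<in> generated n (rook_generators n)"
proof -
  define \<pi> where "\<pi> = transpose i (1 :: nat)"
  have \<pi>: "\<pi> permutes {1..n}"
    unfolding \<pi>_def using n i by (intro permutes_swap_id) auto
  have eq: "\<pi> k = \<pi> l \<longleftrightarrow> k = l" "\<pi> k = 1 \<longleftrightarrow> k = i" for k l
    by (auto simp: \<pi>_def transpose_def)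
  have lab: "{Plain k} - {Plain l} = (if k = l then {} else {Plain k})" for k l by simp
  have gen: "dot_rp n 1 \<in> generated n (rook_generators n)"
    by (rule semigroup_generate.incl) (simp add: rook_generators_def)
  have "partition_of n (case_vertex (\<lambda>k. {Plain (\<pi> k)} - {Plain 1}) (\<lambda>k. {Plain (\<pi> k)} - {Plain 1}) (\<lambda>_. {}))
      \<in> generated n (rook_generators n)"
    using relabelled_generated[OF n \<pi> gen[unfolded dot_rp_def]] by (simp only: vertex.case)
  also have "partition_of n (case_vertex (\<lambda>k. {Plain (\<pi> k)} - {Plain 1}) (\<lambda>k. {Plain (\<pi> k)} - {Plain 1}) (\<lambda>_. {}))
      = dot_rp n i"
    unfolding dot_rp_def lab
    by (rule partition_of_eqI; elim points_cases) (simp_all add: eq del: One_nat_def split: if_splits)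
  finally show ?thesis .
qed

lemma single_rp_generated:
  assumes n: "n \<ge> 2" and i: "i \<in> {1..n}"
  shows "single_rp n i \<in> generated n (rook_generators n)"
proof -
  define \<pi> where "\<pi> = transpose i (1 :: nat)"
  have \<pi>: "\<pi> permutes {1..n}"
    unfolding \<pi>_def using n i by (intro permutes_swap_id) auto
  have eq: "\<pi> k = \<pi> l \<longleftrightarrow> k = l" "\<pi> k = 1 \<longleftrightarrow> k = i" for k l
    by (auto simp: \<pi>_def transpose_def)
  have gen: "single_rp n 1 \<in> generated n (rook_generators n)"
    by (rule semigroup_generate.incl) (simp add: rook_generators_def)
  have "partition_of n (case_vertex (\<lambda>k. if \<pi> k = 1 then {Prime 1} else {Plain (\<pi> k)})
      (\<lambda>k. {Plain (\<pi> k)}) (\<lambda>_. {})) \<in> generated n (rook_generators n)"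
    using relabelled_generated[OF n \<pi> gen[unfolded single_rp_def]] by (simp only: vertex.case)
  also have "partition_of n (case_vertex (\<lambda>k. if \<pi> k = 1 then {Prime 1} else {Plain (\<pi> k)})
      (\<lambda>k. {Plain (\<pi> k)}) (\<lambda>_. {})) = single_rp n i"
    unfolding single_rp_def
    by (rule partition_of_eqI; elim points_cases) (simp_all add: eq del: One_nat_def split: if_splits)
  finally show ?thesis .
qed

text \<open>Under these conditions blocks are singletons or pairs across the rows. An upper
  singleton forces a lower one; tying them together is undone by \<open>single_rp\<close> and lowers
  the number of upper singletons, until a permutation remains.\<close>

lemma matching_generated:
  assumes n: "n \<ge> 2" and "\<alpha> \<in> rook_partitions n"
    and "\<not> dotted n \<alpha>" "\<not> joined n \<alpha>" "\<not> dotted n (star \<alpha>)" "\<not> joined n (star \<alpha>)"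
  shows "\<alpha> \<in> generated n (rook_generators n)"
  using assms(2-)
proof (induction "card {i \<in> {1..n}. block_of \<alpha> (Plain i) = {Plain i}}" arbitrary: \<alpha> rule: less_induct)
  case less
  note \<alpha> = less.prems(1)
  let ?a = "block_of \<alpha>"
  have dot: "?a (Plain i) \<noteq> {}" "?a (Prime i) \<noteq> {}" if "i \<in> {1..n}" for i
    using less.prems(2,4) that unfolding dotted_def block_of_star_empty_iff flip.simps by blast+
  have inj: "i = j" if "?a (Plain i) = ?a (Plain j)" "i \<in> {1..n}" "j \<in> {1..n}" for i j
    using less.prems(3) that unfolding joined_def by blast
  have inj': "i = j" if "?a (Prime i) = ?a (Prime j)" "i \<in> {1..n}" "j \<in> {1..n}" for i j
    using less.prems(5) that unfolding joined_def block_of_star_eq_iff flip.simps by blast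
  have self: "x = y" if "?a y = {x}" for x y
    using mem_block_of_self[of \<alpha> y] that by simp
  have mem: "y \<in> points n \<and> ?a y = ?a x" if "y \<in> ?a x" for x y
    using mem_block_of_eq[OF \<alpha> that] block_of_subset[OF \<alpha>, of x] that by blast
  show ?case
  proof (cases "hanging n \<alpha>")
    case False
    then have "defects n \<alpha> = (False, False, False)"
      using less.prems unfolding defects_def by simp
    then obtain \<pi> where "\<pi> permutes {1..n}" "\<alpha> = perm_rp n \<pi>" by (rule perm_rp_cases[OF \<alpha>])
    then show ?thesis using perm_rp_generated[OF n] by simp
  next
    case True
    then obtain i where i: "i \<in> {1..n}" and no: "\<And>j. j \<in> {1..n} \<Longrightarrow> ?a (Prime j) \<noteq> ?a (Plain i)"
      unfolding hanging_def by blast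
    have "y = Plain i" if y: "y \<in> ?a (Plain i)" for y
    proof -
      have "y \<in> points n" "?a y = ?a (Plain i)" using mem[OF y] by blast+
      then show ?thesis by (elim points_cases) (use no inj i in auto)
    qed
    then have ai: "?a (Plain i) = {Plain i}" using dot(1)[OF i] by blast
    \<comment> \<open>Otherwise the \<open>n\<close> distinct blocks of lower points would be among
      the \<open>n\<close> blocks of upper points, hence would exhaust them, including that of
      \<open>i\<close>.\<close>
    have "\<exists>j \<in> {1..n}. ?a (Prime j) = {Prime j}"
    proof (rule ccontr)
      assume neg: "\<not> ?thesis"
      have "?a (Prime j) \<in> (\<lambda>k. ?a (Plain k)) ` {1..n}" if j: "j \<in> {1..n}" for j
      proof -
        have "?a (Prime j) \<noteq> {Prime j}" using neg j by blast
        then obtain y where y: "y \<in> ?a (Prime j)" "y \<noteq> Prime j" using dot(2)[OF j] by blast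
        have "y \<in> points n" "?a y = ?a (Prime j)" using mem[OF y(1)] by blast+
        then show ?thesis
        proof (cases rule: points_cases)
          case (1 k)
          then show ?thesis using \<open>?a y = ?a (Prime j)\<close> by (intro image_eqI[of _ _ k]) simp_all
        next
          case (2 k)
          then show ?thesis using \<open>?a y = ?a (Prime j)\<close> inj'[of k j] j y(2) by simp
        qed
      qed
      then have sub: "(\<lambda>k. ?a (Prime k)) ` {1..n} \<subseteq> (\<lambda>k. ?a (Plain k)) ` {1..n}" by blast
      have "inj_on (\<lambda>k. ?a (Prime k)) {1..n}" "inj_on (\<lambda>k. ?a (Plain k)) {1..n}"
        using inj inj' by (auto intro!: inj_onI simp del: atLeastAtMost_iff)
      then have "card ((\<lambda>k. ?a (Prime k)) ` {1..n}) = card ((\<lambda>k. ?a (Plain k)) ` {1..n})"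
        by (simp add: card_image)
      then have "(\<lambda>k. ?a (Prime k)) ` {1..n} = (\<lambda>k. ?a (Plain k)) ` {1..n}"
        using sub by (intro card_subset_eq) simp_all
      then have "?a (Plain i) \<in> (\<lambda>k. ?a (Prime k)) ` {1..n}" using i by blast
      then show False using no by (metis imageE)
    qed
    then obtain j where j: "j \<in> {1..n}" and aj: "?a (Prime j) = {Prime j}" by blast
    let ?b = "?a(Plain i := {Prime j})"
    let ?\<beta> = "partition_of n ?b"
    have "?\<beta> \<in> generated n (rook_generators n)"
    proof (rule less.hyps[OF _ partition_of_in_rook_partitions])
      \<comment> \<open>Tying \<open>i\<close> to the lower \<open>j\<close> creates no upper
        singleton and removes the one at \<open>i\<close>.\<close>
      have key: "k \<noteq> i \<and> ?a (Plain k) = {Plain k}" if k: "k \<in> {1..n}" and eq: "block_of ?\<beta> (Plain k) = {Plain k}" for k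
      proof
        show ne: "k \<noteq> i"
        proof
          assume "k = i"
          then have "Prime j \<in> block_of ?\<beta> (Plain k)"
            using k j aj by (simp add: block_of_partition_of)
          then show False using eq by simp
        qed
        have "z = Plain k" if z: "z \<in> ?a (Plain k)" for z
        proof -
          have z': "z \<in> points n" "?a z = ?a (Plain k)" using mem[OF z] by blast+
          then have "z \<noteq> Plain i" using inj[of i k] i k ne by auto
          then have "z \<in> block_of ?\<beta> (Plain k)"
            using z' k ne dot(1)[OF k] by (simp add: block_of_partition_of)
          then show ?thesis using eq by simp
        qed
        then show "?a (Plain k) = {Plain k}" using dot(1)[OF k] by blast
      qed
      have "{k \<in> {1..n}. block_of ?\<beta> (Plain k) = {Plain k}} \<subset> {k \<in> {1..n}. ?a (Plain k) = {Plain k}}"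
      proof (rule psubsetI)
        show "{k \<in> {1..n}. block_of ?\<beta> (Plain k) = {Plain k}} \<subseteq> {k \<in> {1..n}. ?a (Plain k) = {Plain k}}"
          using key by (intro Collect_mono) simp
        have "i \<notin> {k \<in> {1..n}. block_of ?\<beta> (Plain k) = {Plain k}}" using key[of i] by blast
        moreover have "i \<in> {k \<in> {1..n}. ?a (Plain k) = {Plain k}}" using i ai by simp
        ultimately show "{k \<in> {1..n}. block_of ?\<beta> (Plain k) = {Plain k}} \<noteq> {k \<in> {1..n}. ?a (Plain k) = {Plain k}}"
          by metis
      qed
      then show "card {k \<in> {1..n}. block_of ?\<beta> (Plain k) = {Plain k}} < card {k \<in> {1..n}. ?a (Plain k) = {Plain k}}"
        by (rule psubset_card_mono[rotated]) simp
      show "\<not> dotted n ?\<beta>" "\<not> dotted n (star ?\<beta>)"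
        unfolding star_partition_of defects_partition_of using dot by auto
      \<comment> \<open>The label given to \<open>i\<close> is not yet used in the upper row, so the
        upper labels stay distinct.\<close>
      have new: "?a (Plain k) \<noteq> {Prime j}" for k using self[of "Plain k" "Prime j"] by auto
      have "k = l" if "k \<in> {1..n}" "l \<in> {1..n}" "?b (Plain k) = ?b (Plain l)" for k l
        using that new[of k] new[of l] inj[of k l] by (auto split: if_splits)
      then show "\<not> joined n ?\<beta>" unfolding defects_partition_of by blast
      have "k = l" if "k \<in> {1..n}" "l \<in> {1..n}" "?b (flip (Plain k)) = ?b (flip (Plain l))" for k l
        using that inj'[of k l] by simp
      then show "\<not> joined n (star ?\<beta>)" unfolding star_partition_of defects_partition_of by blast
    qed
    then have "rook_mult n (single_rp n i) ?\<beta> \<in> generated n (rook_generators n)"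
      by (rule generated_mult[OF single_rp_generated[OF n i]])
    then show ?thesis by (simp add: single_rp_mult[OF \<alpha> i j ai aj])
  qed
qed

section \<open>Reduction to partial matchings\<close>

text \<open>The decreasing measure: the points that are not blocks on their own.\<close>

definition linked :: "nat \<Rightarrow> vertex set set \<Rightarrow> vertex set" where
  "linked n \<alpha> = {x \<in> points n. block_of \<alpha> x \<noteq> {x}}"

lemma finite_points: "finite (points n)"
  by (simp add: points_def)

lemma card_linked_star: "card (linked n (star \<alpha>)) = card (linked n \<alpha>)"
proof -
  have "block_of (star \<alpha>) x = {x} \<longleftrightarrow> block_of \<alpha> (flip x) = {flip x}" for x
    unfolding block_of_star by (metis flip_flip image_empty image_insert inj_flip inj_image_eq_iff)
  then have "linked n (star \<alpha>) = flip ` linked n \<alpha>"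
    unfolding linked_def by (auto intro!: image_eqI[of _ flip "flip _"])
  then show ?thesis by (simp add: card_image inj_on_subset[OF inj_flip])
qed

text \<open>Singleton blocks stay singletons, and \<open>p\<close> becomes a new one. Dots count as
  linked, so turning a dot into a singleton also lowers the measure.\<close>

lemma card_linked_isolate:
  assumes \<alpha>: "\<alpha> \<in> rook_partitions n" and p: "p \<in> points n" "block_of \<alpha> p \<noteq> {p}"
  shows "card (linked n (isolate n p \<alpha>)) < card (linked n \<alpha>)"
proof -
  let ?b = "(block_of \<alpha>)(p := {p})"
  have blk: "block_of (isolate n p \<alpha>) x = {x}" if x: "x \<in> points n" "x = p \<or> block_of \<alpha> x = {x}" for x
  proof -
    have bx: "?b x = {x}" using x by auto
    have uniq: "y = x" if "?b y = {x}" for y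
      using that mem_block_of_self[of \<alpha> y] by (auto split: if_splits)
    have "{y \<in> points n. ?b y = ?b x} = {x}"
    proof (intro equalityI subsetI)
      fix y assume "y \<in> {y \<in> points n. ?b y = ?b x}"
      then show "y \<in> {x}" using uniq[of y] bx by simp
    next
      fix y assume "y \<in> {x}"
      then show "y \<in> {y \<in> points n. ?b y = ?b x}" using x(1) by simp
    qed
    then show ?thesis
      using bx unfolding isolate_def by (subst block_of_partition_of[OF x(1)]) simp
  qed
  have "linked n (isolate n p \<alpha>) \<subseteq> linked n \<alpha>"
    unfolding linked_def using blk by (intro Collect_mono) metis
  moreover have "p \<in> linked n \<alpha>" "p \<notin> linked n (isolate n p \<alpha>)"
    using p blk[of p] unfolding linked_def by simp_all
  ultimately have "linked n (isolate n p \<alpha>) \<subset> linked n \<alpha>"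
    by (metis psubsetI)
  then show ?thesis by (intro psubset_card_mono) (simp_all add: linked_def finite_points)
qed

text \<open>A dot or an identification in the upper row involves an upper point that is no singleton
  block. Isolating it lowers the measure, and left multiplication by \<open>dot_rp\<close> or
  \<open>join_rp\<close> recovers \<alpha>.\<close>

lemma generated_step:
  assumes n: "n \<ge> 2" and \<alpha>: "\<alpha> \<in> rook_partitions n" and "dotted n \<alpha> \<or> joined n \<alpha>"
    and IH: "\<And>\<beta>. card (linked n \<beta>) < card (linked n \<alpha>) \<Longrightarrow> \<beta> \<in> rook_partitions n \<Longrightarrow>
      \<beta> \<in> generated n (rook_generators n)"
  shows "\<alpha> \<in> generated n (rook_generators n)"
proof -
  have iso: "isolate n (Plain i) \<alpha> \<in> generated n (rook_generators n)"
    if "i \<in> {1..n}" "block_of \<alpha> (Plain i) \<noteq> {Plain i}" for i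
    using that by (intro IH card_linked_isolate[OF \<alpha>])
      (simp_all add: isolate_def partition_of_in_rook_partitions)
  from assms(3) show ?thesis
  proof
    assume "dotted n \<alpha>"
    then obtain i where i: "i \<in> {1..n}" "block_of \<alpha> (Plain i) = {}" unfolding dotted_def by blast
    then have "rook_mult n (dot_rp n i) (isolate n (Plain i) \<alpha>) \<in> generated n (rook_generators n)"
      by (intro generated_mult dot_rp_generated n iso) simp_all
    then show ?thesis by (simp add: dot_rp_mult_isolate[OF \<alpha> i])
  next
    assume "joined n \<alpha>"
    then obtain i j where ij: "i \<in> {1..n}" "j \<in> {1..n}" "i \<noteq> j"
      and eq: "block_of \<alpha> (Plain i) = block_of \<alpha> (Plain j)" unfolding joined_def by blast
    have "block_of \<alpha> (Plain i) \<noteq> {Plain i}"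
    proof
      assume "block_of \<alpha> (Plain i) = {Plain i}"
      then have "Plain j \<in> {Plain i}" using eq mem_block_of_self[of \<alpha> "Plain j"] by simp
      with ij(3) show False by simp
    qed
    then have "rook_mult n (join_rp n i j) (isolate n (Plain i) \<alpha>) \<in> generated n (rook_generators n)"
      by (intro generated_mult join_rp_generated n iso ij)
    then show ?thesis by (simp add: join_rp_mult_isolate[OF \<alpha> ij eq])
  qed
qed

lemma generated_rook_generators:
  assumes n: "n \<ge> 2"
  shows "generated n (rook_generators n) = rook_partitions n"
proof
  show "generated n (rook_generators n) \<subseteq> rook_partitions n"
    by (rule semigroup_generate_subset[OF rook_generators_subset])
  have "\<alpha> \<in> generated n (rook_generators n)" if "\<alpha> \<in> rook_partitions n" for \<alpha>
    using that
  proof (induction "card (linked n \<alpha>)" arbitrary: \<alpha> rule: less_induct)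
    case less
    consider "dotted n \<alpha> \<or> joined n \<alpha>" | "dotted n (star \<alpha>) \<or> joined n (star \<alpha>)"
      | "\<not> dotted n \<alpha>" "\<not> joined n \<alpha>" "\<not> dotted n (star \<alpha>)" "\<not> joined n (star \<alpha>)" by blast
    then show ?case
    proof cases
      case 1
      then show ?thesis by (rule generated_step[OF n less.prems]) (rule less.hyps)
    next
      case 2
      \<comment> \<open>A dot or an identification in the lower row lies in the upper row of the
        reflection, which has the same measure.\<close>
      have "star \<alpha> \<in> generated n (rook_generators n)"
        by (rule generated_step[OF n star_in_rook_partitions[OF less.prems] 2])
          (simp add: card_linked_star less.hyps)
      then show ?thesis using star_generated[OF n] by (metis star_star)
    next
      case 3
      then show ?thesis by (rule matching_generated[OF n less.prems])
    qed
  qed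
  then show "rook_partitions n \<subseteq> generated n (rook_generators n)" by blast
qed

theorem theorem4p14:
  fixes n :: nat
  assumes "n \<ge> 3"
  shows "semigroup_rank (rook_partition_monoid n) = 5"
proof -
  have carrier: "carrier (rook_partition_monoid n) = rook_partitions n"
    by (simp add: rook_partition_monoid_def)
  have gen: "generated n (rook_generators n) = rook_partitions n"
    using assms by (intro generated_rook_generators) simp
  have "card (rook_generators n) \<le> 5"
    unfolding rook_generators_def by (intro card_insert_le_m1 order.refl) (simp_all add: card_insert_if)
  \<comment> \<open>The lower bound, applied to the generators themselves, shows that they are
    pairwise distinct.\<close>
  then have card: "card (rook_generators n) = 5"
    using card_generating_set_ge[OF assms rook_generators_subset gen] by simp
  have "finite (rook_generators n)" by (simp add: rook_generators_def)
  show ?thesis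
    unfolding semigroup_rank_def carrier
  proof (rule Least_equality)
    show "\<exists>A \<subseteq> rook_partitions n. finite A \<and> card A = 5 \<and> generated n A = rook_partitions n"
      using rook_generators_subset \<open>finite (rook_generators n)\<close> card gen by blast
  next
    fix k
    assume "\<exists>A \<subseteq> rook_partitions n. finite A \<and> card A = k \<and> generated n A = rook_partitions n"
    then show "5 \<le> k" using card_generating_set_ge[OF assms] by blast
  qed
qed

end
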